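(* Let $\Omega\subseteq\mathbb{R}^d$ be open, $p\in[1,\infty)$, $m\in\mathbb{N}$, $V=\{w_\alpha\}_{\alpha\in\pi_m}$ a family of elements of $E_p(\Omega)$, and $v\in\mathcal{C}^{m,*}(\Omega)$. Assume that for every $\alpha\in\pi_m$ and every $K\Subset\Omega$ there is $C_K>0$ with $|v(x)|^{|\alpha|+1}\le C_K|w_\alpha(x)|$ for a.e. $x\in K$. Then the normed space $W^{m,p}_{V,v}(\Omega)$ is complete (a Banach space).
   Context: Throughout, $\Omega\subseteq\mathbb{R}^d$ is open, $\mathbb{N}=\{0,1,2,\dots\}$, $p\in[1,\infty)$, $K\Subset\Omega$ means $K$ is a compact subset of $\Omega$, $\pi_m=\{\alpha\in\mathbb{N}^d:|\alpha|\le m\}$ and $\pi_m^0=\pi_m\setminus\{0\}$. A weight on $\Omega$ is a locally integrable function positive a.e.; $E_p(\Omega)$ is the set of measurable $w$ with $|w|^p$ a weight. For measurable $u$, $L^p_u(\Omega)$ is the space of measurable $f$ with $fu\in L^p(\Omega)$, normed by $\|fu\|_{L^p}$; $L^p_{u,\mathrm{loc}}$ means $fu\in L^p(K)$ for all $K\Subset\Omega$. $\mathcal{C}^{k,*}(\Omega)$ is the set of $v\in\mathcal{C}^k(\Omega)$ with $v\ne0$ a.e. Condition (H) for $v$ with respect to $w$: for every $K\Subset\Omega$ there is $C>0$ with $|v|\le C|w|$ a.e. in $K$. Weak derivative in the sense of $L^1_{v,\mathrm{loc}}(\Omega)$: for $|\alpha|\ge1$, $w\in E_p(\Omega)$ and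 $v\in\mathcal{C}^{|\alpha|,*}(\Omega)$ satisfying (H) w.r.t. $w$, $f\in L^1_{w,\mathrm{loc}}(\Omega)$ has such a derivative if there is $g\in L^1_{v^{|\alpha|+1},\mathrm{loc}}(\Omega)$ with $\int_\Omega f\,\partial^\alpha(v^{|\alpha|+1}\phi)\,dx=(-1)^{|\alpha|}\int_\Omega v^{|\alpha|+1}\phi\,g\,dx$ for all $\phi\in C_c^\infty(\Omega)$; $g=:D^\alpha_vf$ is unique; $D^0_vf:=f$. For $m\in\mathbb{N}$, $V=\{w_\alpha\}_{\alpha\in\pi_m}\subset E_p(\Omega)$ and $v\in\mathcal{C}^{m,*}(\Omega)$ satisfying (H) w.r.t. $w_0$, the space $W^{m,p}_{V,v}(\Omega)$ consists of all $f\in L^p_{w_0}(\Omega)$ such that for every $\alpha\in\pi_m^0$, $D^\alpha_vf$ exists and lies in $L^p_{w_\alpha}(\Omega)$; norm $\|f\|_{W^{m,p}_{V,v}}=\big(\sum_{\alpha\in\pi_m}\|w_\alpha D^\alpha_vf\|_{L^p}^p\big)^{1/p}$. (The hypothesis with $\alpha=0$ gives (H) w.r.t. $w_0$.) *)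

theory Defs
  imports "HOL-Analysis.Analysis"
begin

type_synonym 'n mindex = "'n \<Rightarrow> nat"

definition mlen :: "('n::finite) mindex \<Rightarrow> nat" where
  "mlen \<alpha> = (\<Sum>i\<in>UNIV. \<alpha> i)"

definition pim :: "nat \<Rightarrow> ('n::finite) mindex set" where
  "pim m = {\<alpha>. mlen \<alpha> \<le> m}"

definition pdiff :: "'n::finite \<Rightarrow> (real^'n \<Rightarrow> real) \<Rightarrow> real^'n \<Rightarrow> real" where
  "pdiff i f x = deriv (\<lambda>t. f (x + t *\<^sub>R axis i 1)) 0"

fun pdiffs :: "('n::finite) list \<Rightarrow> (real^'n \<Rightarrow> real) \<Rightarrow> real^'n \<Rightarrow> real" where
  "pdiffs [] f = f"
| "pdiffs (i # is) f = pdiff i (pdiffs is f)"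

definition enum_idx :: "('n::finite) list" where
  "enum_idx = (SOME xs. distinct xs \<and> set xs = UNIV)"

definition Dcl :: "('n::finite) mindex \<Rightarrow> (real^'n \<Rightarrow> real) \<Rightarrow> real^'n \<Rightarrow> real" where
  "Dcl \<alpha> f = pdiffs (concat (map (\<lambda>i. replicate (\<alpha> i) i) enum_idx)) f"

definition Ck_on :: "nat \<Rightarrow> (real^'n::finite) set \<Rightarrow> (real^'n \<Rightarrow> real) \<Rightarrow> bool" where
  "Ck_on k \<Omega> f \<longleftrightarrow>
     (\<forall>is. length is \<le> k \<longrightarrow> continuous_on \<Omega> (pdiffs is f)) \<and>
     (\<forall>is i. length is < k \<longrightarrow> (\<forall>x\<in>\<Omega>.
        ((\<lambda>t. pdiffs is f (x + t *\<^sub>R axis i 1)) has_real_derivative pdiffs (i # is) f x) (at 0)))"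

definition test_fun :: "(real^'n::finite) set \<Rightarrow> (real^'n \<Rightarrow> real) \<Rightarrow> bool" where
  "test_fun \<Omega> \<phi> \<longleftrightarrow> (\<forall>k. Ck_on k UNIV \<phi>) \<and>
     compact (closure {x. \<phi> x \<noteq> 0}) \<and> closure {x. \<phi> x \<noteq> 0} \<subseteq> \<Omega>"

definition weight :: "(real^'n::finite) set \<Rightarrow> (real^'n \<Rightarrow> real) \<Rightarrow> bool" where
  "weight \<Omega> u \<longleftrightarrow>
     (\<forall>K. compact K \<and> K \<subseteq> \<Omega> \<longrightarrow> set_integrable lebesgue K u) \<and>
     (AE x in lebesgue. x \<in> \<Omega> \<longrightarrow> u x > 0)"

definition Ep :: "real \<Rightarrow> (real^'n::finite) set \<Rightarrow> (real^'n \<Rightarrow> real) set" where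
  "Ep p \<Omega> = {w. set_borel_measurable lebesgue \<Omega> w \<and> weight \<Omega> (\<lambda>x. \<bar>w x\<bar> powr p)}"

definition Lpw :: "real \<Rightarrow> (real^'n::finite) set \<Rightarrow> (real^'n \<Rightarrow> real) \<Rightarrow> (real^'n \<Rightarrow> real) set" where
  "Lpw p \<Omega> u = {f. set_borel_measurable lebesgue \<Omega> f \<and>
       set_integrable lebesgue \<Omega> (\<lambda>x. \<bar>f x * u x\<bar> powr p)}"

definition L1w_loc :: "(real^'n::finite) set \<Rightarrow> (real^'n \<Rightarrow> real) \<Rightarrow> (real^'n \<Rightarrow> real) set" where
  "L1w_loc \<Omega> u = {f. set_borel_measurable lebesgue \<Omega> f \<and>
       (\<forall>K. compact K \<and> K \<subseteq> \<Omega> \<longrightarrow> set_integrable lebesgue K (\<lambda>x. \<bar>f x * u x\<bar>))}"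

definition is_wderiv :: "(real^'n::finite) set \<Rightarrow> (real^'n \<Rightarrow> real) \<Rightarrow> 'n mindex
     \<Rightarrow> (real^'n \<Rightarrow> real) \<Rightarrow> (real^'n \<Rightarrow> real) \<Rightarrow> bool" where
  "is_wderiv \<Omega> v \<alpha> f g \<longleftrightarrow>
     g \<in> L1w_loc \<Omega> (\<lambda>x. v x ^ (mlen \<alpha> + 1)) \<and>
     (\<forall>\<phi>. test_fun \<Omega> \<phi> \<longrightarrow>
        (LINT x:\<Omega>|lebesgue. f x * Dcl \<alpha> (\<lambda>y. v y ^ (mlen \<alpha> + 1) * \<phi> y) x)
        = (-1) ^ mlen \<alpha> * (LINT x:\<Omega>|lebesgue. v x ^ (mlen \<alpha> + 1) * \<phi> x * g x))"

text \<open>D^alpha_v f (a chosen representative; it is unique a.e.), D^0_v f = f\<close>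
definition Dv :: "(real^'n::finite) set \<Rightarrow> (real^'n \<Rightarrow> real) \<Rightarrow> 'n mindex
     \<Rightarrow> (real^'n \<Rightarrow> real) \<Rightarrow> (real^'n \<Rightarrow> real)" where
  "Dv \<Omega> v \<alpha> f = (if mlen \<alpha> = 0 then f else (SOME g. is_wderiv \<Omega> v \<alpha> f g))"

definition Wsp :: "nat \<Rightarrow> real \<Rightarrow> (real^'n::finite) set \<Rightarrow> ('n mindex \<Rightarrow> real^'n \<Rightarrow> real)
     \<Rightarrow> (real^'n \<Rightarrow> real) \<Rightarrow> (real^'n \<Rightarrow> real) set" where
  "Wsp m p \<Omega> w v = {f. f \<in> Lpw p \<Omega> (w (\<lambda>_. 0)) \<and>
     (\<forall>\<alpha>\<in>pim m. mlen \<alpha> \<noteq> 0 \<longrightarrow>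
        (\<exists>g. is_wderiv \<Omega> v \<alpha> f g) \<and> Dv \<Omega> v \<alpha> f \<in> Lpw p \<Omega> (w \<alpha>))}"

definition Wnorm :: "nat \<Rightarrow> real \<Rightarrow> (real^'n::finite) set \<Rightarrow> ('n mindex \<Rightarrow> real^'n \<Rightarrow> real)
     \<Rightarrow> (real^'n \<Rightarrow> real) \<Rightarrow> (real^'n \<Rightarrow> real) \<Rightarrow> real" where
  "Wnorm m p \<Omega> w v f =
     (\<Sum>\<alpha>\<in>pim m. LINT x:\<Omega>|lebesgue. \<bar>w \<alpha> x * Dv \<Omega> v \<alpha> f x\<bar> powr p) powr (1 / p)"

end

theory Submission
  imports Defs
begin

text \<open>
  If \<open>(F n)\<close> is Cauchy in the Sobolev norm, each \<open>w \<alpha> * Dv \<Omega> v \<alpha> (F n)\<close> is Cauchy in unweighted \<open>L\<^sup>p\<close>,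
  hence converges there; divide the limit by \<open>w \<alpha>\<close> to get \<open>g \<alpha>\<close>. Writing \<open>k\<close> for the order of
  \<open>\<alpha>\<close>, the bound \<open>\<bar>v\<bar>^(k + 1) \<le> C \<bar>w \<alpha>\<bar>\<close> on compact sets turns weighted
  \<open>L\<^sup>p\<close> convergence into local \<open>L\<^sup>1\<close> convergence of \<open>v^(k + 1) * Dv \<Omega> v \<alpha> (F n)\<close>, and of \<open>v * F n\<close>
  when \<open>\<alpha> = 0\<close>. Since \<open>k\<close> derivatives of \<open>v^(k + 1) * \<phi>\<close> leave at least one factor \<open>v\<close>, both sides
  of the identity defining the weak derivative pass to the limit, so \<open>g \<alpha>\<close> is the weak
  derivative of \<open>g 0\<close>. Weak derivatives are unique almost everywhere by du Bois-Reymond's lemma,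
  so this applies to the representative selected by \<open>Dv\<close>.
\<close>

section \<open>Completeness of Lp\<close>

text \<open>Elements of the space are functions, not classes, and \<open>Dv\<close> picks a
  derivative by \<open>SOME\<close>, so \<open>Dv\<close> is additive only up to null sets.
  Uniqueness therefore acts not only at the limit but already at the start, where the norm of
  \<open>F n - F k\<close> has to be read as a distance between the chosen derivatives. A member
  \<open>f\<close> need not be locally integrable; only \<open>f * v\<close> is controlled, by the
  bound for the zero multi-index. This explains the exponent \<open>mlen \<alpha> + 1\<close>: after
  \<open>mlen \<alpha>\<close> derivatives one factor \<open>v\<close> is still there to be paired
  with \<open>f\<close>, and the same power of \<open>v\<close> multiplies the derivative on the
  other side. What else the derivatives produce is a continuous cofactor on the support of the test
  function; all that matters about it is that it exists and does not depend on \<open>f\<close>. Lp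
  is treated through integrals of \<open>p\<close>-th powers, and the passage to L1 on compact sets
  rests on one pointwise inequality that covers all \<open>p \<ge> 1\<close> alike.\<close>

lemma abs_diff_powr_le:
  fixes a b p :: real
  assumes "0 < p"
  shows "\<bar>a - b\<bar> powr p \<le> 2 powr p * (\<bar>a\<bar> powr p + \<bar>b\<bar> powr p)"
proof -
  have "\<bar>a - b\<bar> powr p \<le> (2 * max \<bar>a\<bar> \<bar>b\<bar>) powr p"
    using assms by (intro powr_mono2) auto
  also have "\<dots> = 2 powr p * max \<bar>a\<bar> \<bar>b\<bar> powr p"
    by (simp add: powr_mult)
  also have "\<dots> \<le> 2 powr p * (\<bar>a\<bar> powr p + \<bar>b\<bar> powr p)"
    by (intro mult_left_mono) (auto simp: max_def)
  finally show ?thesis .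
qed

lemma integrable_powr_diff:
  fixes f g :: "'a \<Rightarrow> real"
  assumes "0 < p" "f \<in> borel_measurable M" "g \<in> borel_measurable M"
    "integrable M (\<lambda>x. \<bar>f x\<bar> powr p)" "integrable M (\<lambda>x. \<bar>g x\<bar> powr p)"
  shows "integrable M (\<lambda>x. \<bar>f x - g x\<bar> powr p)"
proof (rule Bochner_Integration.integrable_bound)
  show "integrable M (\<lambda>x. 2 powr p * (\<bar>f x\<bar> powr p + \<bar>g x\<bar> powr p))"
    using assms by auto
  show "(\<lambda>x. \<bar>f x - g x\<bar> powr p) \<in> borel_measurable M"
    using assms by auto
qed (auto intro!: abs_diff_powr_le assms)

lemma convergent_of_summable_diff:
  fixes f :: "nat \<Rightarrow> real"
  assumes "summable (\<lambda>k. f (Suc k) - f k)"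
  shows "convergent f"
proof -
  have "(\<lambda>n. (\<Sum>k<n. f (Suc k) - f k) + f 0) \<longlonglongrightarrow> (\<Sum>k. f (Suc k) - f k) + f 0"
    by (intro tendsto_add summable_LIMSEQ assms tendsto_const)
  then show ?thesis
    by (auto simp: sum_lessThan_telescope convergent_def)
qed

text \<open>The weights \<open>2 powr (k * p)\<close> avoid Minkowski's inequality: integrability of the weighted sum
  of \<open>p\<close>-th powers already forces the increments below \<open>2 powr (- k)\<close> almost everywhere.\<close>

lemma AE_convergent_of_fast_Lp_Cauchy:
  fixes u :: "nat \<Rightarrow> 'a \<Rightarrow> real"
  assumes "0 < p" and [measurable]: "\<And>n. u n \<in> borel_measurable M"
    and int: "\<And>k. integrable M (\<lambda>x. \<bar>u (Suc k) x - u k x\<bar> powr p)"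
    and fast: "\<And>k. (\<integral>x. \<bar>u (Suc k) x - u k x\<bar> powr p \<partial>M) \<le> (1/2)^k / 2 powr (k * p)"
  shows "AE x in M. convergent (\<lambda>k. u k x)"
proof -
  define d where "d k x = 2 powr (k * p) * \<bar>u (Suc k) x - u k x\<bar> powr p" for k x
  have [measurable]: "d k \<in> borel_measurable M" for k
    unfolding d_def by measurable
  have d0: "0 \<le> d k x" for k x by (simp add: d_def)
  have "(\<integral>\<^sup>+x. (\<Sum>k. ennreal (d k x)) \<partial>M) = (\<Sum>k. \<integral>\<^sup>+x. ennreal (d k x) \<partial>M)"
    by (rule nn_integral_suminf) measurable
  also have "\<dots> \<le> (\<Sum>k. ennreal ((1/2)^k))"
  proof (intro suminf_le summableI)
    fix k
    have "(\<integral>\<^sup>+x. ennreal (d k x) \<partial>M) = ennreal (\<integral>x. d k x \<partial>M)"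
      using int[of k] d0 by (intro nn_integral_eq_integral) (auto simp: d_def)
    also have "\<dots> \<le> ennreal ((1/2)^k)"
      using mult_left_mono[OF fast[of k], of "2 powr (k * p)"] by (intro ennreal_leI) (auto simp: d_def)
    finally show "(\<integral>\<^sup>+x. ennreal (d k x) \<partial>M) \<le> ennreal ((1/2)^k)" .
  qed
  also have "\<dots> = ennreal (\<Sum>k. (1/2)^k)"
    by (intro suminf_ennreal2) (auto intro: summable_geometric)
  finally have "(\<integral>\<^sup>+x. (\<Sum>k. ennreal (d k x)) \<partial>M) \<noteq> \<infinity>"
    by (auto simp: top_unique)
  then have "AE x in M. (\<Sum>k. ennreal (d k x)) \<noteq> \<infinity>"
    by (intro nn_integral_PInf_AE) measurable
  then show ?thesis
  proof (rule AE_mp, intro AE_I2 impI)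
    fix x assume "(\<Sum>k. ennreal (d k x)) \<noteq> \<infinity>"
    then have "summable (\<lambda>k. d k x)"
      using d0 by (intro summable_suminf_not_top) auto
    then have "eventually (\<lambda>k. d k x < 1) sequentially"
      using order_tendstoD(2)[OF summable_LIMSEQ_zero, of "\<lambda>k. d k x" 1] by simp
    then have "eventually (\<lambda>k. norm (u (Suc k) x - u k x) \<le> (1/2)^k) sequentially"
    proof (rule eventually_mono)
      fix k assume d1: "d k x < 1"
      show "norm (u (Suc k) x - u k x) \<le> (1/2)^k"
      proof (rule ccontr)
        assume "\<not> ?thesis"
        then have "((1/2)^k) powr p < \<bar>u (Suc k) x - u k x\<bar> powr p"
          using \<open>0 < p\<close> by (intro powr_less_mono2) auto
        then have "2 powr (k * p) * ((1/2)^k) powr p < d k x"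
          unfolding d_def by (intro mult_strict_left_mono) auto
        moreover have "2 powr (k * p) * ((1/2)^k) powr p = (1::real)"
          by (simp add: powr_powr[symmetric] powr_realpow powr_mult[symmetric] power_mult_distrib[symmetric])
        ultimately show False using d1 by simp
      qed
    qed
    then have "summable (\<lambda>k. u (Suc k) x - u k x)"
      by (rule summable_comparison_test_ev) (auto intro: summable_geometric)
    then show "convergent (\<lambda>k. u k x)"
      by (rule convergent_of_summable_diff)
  qed
qed

text \<open>Riesz-Fischer: a rapidly Cauchy subsequence converges almost everywhere. Fatou's lemma
  along it carries the Cauchy estimate for \<open>u n - u (s k)\<close> over to
  \<open>u n - h\<close>, which gives convergence of the whole sequence at once.\<close>

lemma Lp_complete:
  fixes u :: "nat \<Rightarrow> 'a \<Rightarrow> real"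
  assumes "0 < p" and [measurable]: "\<And>n. u n \<in> borel_measurable M"
    and int: "\<And>n. integrable M (\<lambda>x. \<bar>u n x\<bar> powr p)"
    and Cauchy: "\<And>e. e > 0 \<Longrightarrow> \<exists>N. \<forall>n\<ge>N. \<forall>k\<ge>N. (\<integral>x. \<bar>u n x - u k x\<bar> powr p \<partial>M) < e"
  shows "\<exists>h \<in> borel_measurable M. integrable M (\<lambda>x. \<bar>h x\<bar> powr p) \<and>
    (\<lambda>n. \<integral>x. \<bar>u n x - h x\<bar> powr p \<partial>M) \<longlonglongrightarrow> 0"
proof -
  have intd: "integrable M (\<lambda>x. \<bar>u n x - u k x\<bar> powr p)" for n k
    by (intro integrable_powr_diff assms)
  have "\<forall>k::nat. \<exists>N. \<forall>n\<ge>N. \<forall>j\<ge>N. (\<integral>x. \<bar>u n x - u j x\<bar> powr p \<partial>M) < (1/2)^k / 2 powr (k * p)"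
    by (intro allI Cauchy) auto
  then obtain N where N: "\<And>k n j. n \<ge> N k \<Longrightarrow> j \<ge> N k \<Longrightarrow>
      (\<integral>x. \<bar>u n x - u j x\<bar> powr p \<partial>M) < (1/2)^k / 2 powr (real k * p)"
    by metis
  \<comment> \<open>Partial sums make both \<open>s k\<close> and \<open>s (Suc k)\<close> at least
    \<open>N k\<close>, as the fast Cauchy bound requires; the summand \<open>k\<close> sends
    \<open>s k\<close> to infinity.\<close>
  define s where "s k = (\<Sum>i\<le>k. N i) + k" for k
  have sN: "s k \<ge> N k" "s (Suc k) \<ge> N k" "s k \<ge> k" for k
    using member_le_sum[of k "{..k}" N] by (auto simp: s_def)
  have conv: "AE x in M. convergent (\<lambda>k. u (s k) x)"
    by (rule AE_convergent_of_fast_Lp_Cauchy[OF \<open>0 < p\<close>])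
      (auto intro!: intd less_imp_le N sN)
  define h where "h x = lim (\<lambda>k. u (s k) x)" for x
  have [measurable]: "h \<in> borel_measurable M"
    unfolding h_def by measurable
  have close: "\<exists>n0. \<forall>n\<ge>n0. integrable M (\<lambda>x. \<bar>u n x - h x\<bar> powr p) \<and>
    (\<integral>x. \<bar>u n x - h x\<bar> powr p \<partial>M) \<le> e" if "e > 0" for e
  proof -
    from Cauchy[OF that] obtain n0 where
      n0: "\<And>n k. n \<ge> n0 \<Longrightarrow> k \<ge> n0 \<Longrightarrow> (\<integral>x. \<bar>u n x - u k x\<bar> powr p \<partial>M) < e" by blast
    show ?thesis
    proof (intro exI[of _ n0] allI impI)
      fix n assume n: "n \<ge> n0"
      have "(\<integral>\<^sup>+x. ennreal (\<bar>u n x - h x\<bar> powr p) \<partial>M)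
        = (\<integral>\<^sup>+x. liminf (\<lambda>k. ennreal (\<bar>u n x - u (s k) x\<bar> powr p)) \<partial>M)"
      proof (rule nn_integral_cong_AE, rule AE_mp[OF conv], intro AE_I2 impI)
        fix x assume "convergent (\<lambda>k. u (s k) x)"
        then have "(\<lambda>k. u (s k) x) \<longlonglongrightarrow> h x"
          by (simp add: convergent_LIMSEQ_iff h_def)
        then have "(\<lambda>k. ennreal (\<bar>u n x - u (s k) x\<bar> powr p)) \<longlonglongrightarrow> ennreal (\<bar>u n x - h x\<bar> powr p)"
          using \<open>0 < p\<close> by (intro tendsto_intros tendsto_powr2) auto
        then show "ennreal (\<bar>u n x - h x\<bar> powr p) = liminf (\<lambda>k. ennreal (\<bar>u n x - u (s k) x\<bar> powr p))"
          by (rule lim_imp_Liminf[symmetric, OF sequentially_bot])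
      qed
      also have "\<dots> \<le> liminf (\<lambda>k. \<integral>\<^sup>+x. ennreal (\<bar>u n x - u (s k) x\<bar> powr p) \<partial>M)"
        by (rule nn_integral_liminf) measurable
      also have "\<dots> \<le> limsup (\<lambda>k. \<integral>\<^sup>+x. ennreal (\<bar>u n x - u (s k) x\<bar> powr p) \<partial>M)"
        by (rule Liminf_le_Limsup) simp
      also have "\<dots> \<le> ennreal e"
      proof (rule Limsup_bounded, rule eventually_sequentiallyI[of n0])
        fix k assume "k \<ge> n0"
        then have "s k \<ge> n0" using sN(3)[of k] by simp
        then show "(\<integral>\<^sup>+x. ennreal (\<bar>u n x - u (s k) x\<bar> powr p) \<partial>M) \<le> ennreal e"
          using n0[OF n, of "s k"]
          by (subst nn_integral_eq_integral[OF intd]) (auto intro: ennreal_leI)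
      qed
      finally have le: "(\<integral>\<^sup>+x. ennreal (\<bar>u n x - h x\<bar> powr p) \<partial>M) \<le> ennreal e" .
      have I: "integrable M (\<lambda>x. \<bar>u n x - h x\<bar> powr p)"
        by (rule integrableI_nonneg) (use le in \<open>auto simp: le_less_trans\<close>)
      moreover have "(\<integral>x. \<bar>u n x - h x\<bar> powr p \<partial>M) \<le> e"
        using le that by (subst (asm) nn_integral_eq_integral[OF I]) auto
      ultimately show "integrable M (\<lambda>x. \<bar>u n x - h x\<bar> powr p) \<and>
        (\<integral>x. \<bar>u n x - h x\<bar> powr p \<partial>M) \<le> e" ..
    qed
  qed
  from close[of 1] obtain n where I: "integrable M (\<lambda>x. \<bar>u n x - h x\<bar> powr p)" by auto
  \<comment> \<open>The function inside is \<open>h\<close>, written as a difference of two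
    functions whose \<open>p\<close>-th powers are already known to be integrable.\<close>
  have "integrable M (\<lambda>x. \<bar>u n x - (u n x - h x)\<bar> powr p)"
    by (intro integrable_powr_diff I int \<open>0 < p\<close>) measurable
  moreover have "(\<lambda>n. \<integral>x. \<bar>u n x - h x\<bar> powr p \<partial>M) \<longlonglongrightarrow> 0"
  proof (rule LIMSEQ_I)
    fix r :: real assume "r > 0"
    then obtain n0 where "\<forall>n\<ge>n0. (\<integral>x. \<bar>u n x - h x\<bar> powr p \<partial>M) \<le> r / 2"
      using close[of "r / 2"] by auto
    then show "\<exists>no. \<forall>n\<ge>no. norm ((\<integral>x. \<bar>u n x - h x\<bar> powr p \<partial>M) - 0) < r"
      using \<open>r > 0\<close> by (intro exI[of _ n0]) (fastforce simp: abs_of_nonneg integral_nonneg)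
  qed
  ultimately show ?thesis by (intro bexI[of _ h]) auto
qed

section \<open>From Lp to L1 on sets of finite measure\<close>

text \<open>Where \<open>\<bar>t\<bar> > e\<close>, the exponent \<open>1 - p \<le> 0\<close> gives
  \<open>\<bar>t\<bar> powr (1 - p) \<le> e powr (1 - p)\<close>; multiply by
  \<open>\<bar>t\<bar> powr p\<close>. On a set of finite measure the first summand integrates to
  something small and the second is governed by the Lp integral.\<close>

lemma abs_le_powr_bound:
  fixes t e p :: real
  assumes "0 < e" "1 \<le> p"
  shows "\<bar>t\<bar> \<le> e + e powr (1 - p) * \<bar>t\<bar> powr p"
proof (cases "\<bar>t\<bar> \<le> e")
  case False
  have "e powr (p - 1) * \<bar>t\<bar> powr 1 \<le> \<bar>t\<bar> powr (p - 1) * \<bar>t\<bar> powr 1"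
    using False assms by (intro mult_right_mono powr_mono2) auto
  also have "\<dots> = \<bar>t\<bar> powr p"
    using False assms powr_add[of "\<bar>t\<bar>" "p - 1" 1] by simp
  finally have "e powr (1 - p) * (e powr (p - 1) * \<bar>t\<bar>) \<le> e powr (1 - p) * \<bar>t\<bar> powr p"
    using False assms by (intro mult_left_mono) auto
  also have "e powr (1 - p) * (e powr (p - 1) * \<bar>t\<bar>) = \<bar>t\<bar>"
    using assms by (simp add: powr_add[symmetric] mult.assoc[symmetric])
  finally show ?thesis using assms by simp
next
  case True
  moreover have "0 \<le> e powr (1 - p) * \<bar>t\<bar> powr p" by simp
  ultimately show ?thesis by linarith
qed

lemma set_integrable_of_Lp:
  fixes f :: "'a \<Rightarrow> real"
  assumes "1 \<le> p" "K \<in> sets M" "emeasure M K < \<infinity>" "f \<in> borel_measurable M"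
    "integrable M (\<lambda>x. \<bar>f x\<bar> powr p)"
  shows "set_integrable M K f"
  unfolding set_integrable_def
proof (rule Bochner_Integration.integrable_bound)
  show "integrable M (\<lambda>x. indicator K x + \<bar>f x\<bar> powr p)"
    using assms by (intro Bochner_Integration.integrable_add) auto
  show "(\<lambda>x. indicator K x *\<^sub>R f x) \<in> borel_measurable M"
    using assms by measurable
  show "AE x in M. norm (indicat_real K x *\<^sub>R f x) \<le> norm (indicat_real K x + \<bar>f x\<bar> powr p)"
    using abs_le_powr_bound[of 1 p] assms by (auto simp: indicator_def)
qed

lemma L1_tendsto_of_Lp_tendsto:
  fixes f :: "nat \<Rightarrow> 'a \<Rightarrow> real"
  assumes p: "1 \<le> p" and K: "K \<in> sets M" "emeasure M K < \<infinity>"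
    and f: "\<And>n. f n \<in> borel_measurable M" "\<And>n. integrable M (\<lambda>x. \<bar>f n x\<bar> powr p)"
    and lim: "(\<lambda>n. \<integral>x. \<bar>f n x\<bar> powr p \<partial>M) \<longlonglongrightarrow> 0"
  shows "(\<lambda>n. LINT x:K|M. \<bar>f n x\<bar>) \<longlonglongrightarrow> 0"
proof (rule tendstoI)
  fix r :: real assume r: "r > 0"
  \<comment> \<open>Makes \<open>e * measure M K\<close> at most \<open>r / 2\<close>; the
    \<open>+ 1\<close> keeps the denominator positive when \<open>K\<close> is null. The constant
    \<open>e powr (1 - p)\<close> may be large, but it is fixed before \<open>n\<close>
    grows.\<close>
  define e where "e = r / (2 * (measure M K + 1))"
  have e: "e > 0" using r by (simp add: e_def add_nonneg_pos)
  have "r > 0 + e * measure M K"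
    using r by (simp add: e_def field_simps add_nonneg_pos add_pos_nonneg)
  then have "(\<lambda>n. e powr (1 - p) * (\<integral>x. \<bar>f n x\<bar> powr p \<partial>M) + e * measure M K) \<longlonglongrightarrow> e powr (1 - p) * 0 + e * measure M K"
    by (intro tendsto_intros lim)
  then have "eventually (\<lambda>n. e powr (1 - p) * (\<integral>x. \<bar>f n x\<bar> powr p \<partial>M) + e * measure M K < r) sequentially"
    by (rule order_tendstoD(2)) (use \<open>r > 0 + _\<close> in simp)
  then show "eventually (\<lambda>n. dist (LINT x:K|M. \<bar>f n x\<bar>) 0 < r) sequentially"
  proof (rule eventually_mono)
    fix n assume less: "e powr (1 - p) * (\<integral>x. \<bar>f n x\<bar> powr p \<partial>M) + e * measure M K < r"
    have "(LINT x:K|M. \<bar>f n x\<bar>) \<le> (\<integral>x. e * indicator K x + e powr (1 - p) * \<bar>f n x\<bar> powr p \<partial>M)"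
      unfolding set_lebesgue_integral_def
    proof (rule integral_mono)
      show "integrable M (\<lambda>x. indicat_real K x *\<^sub>R \<bar>f n x\<bar>)"
        using set_integrable_of_Lp[OF p K f] set_integrable_abs by (auto simp: set_integrable_def)
      show "integrable M (\<lambda>x. e * indicat_real K x + e powr (1 - p) * \<bar>f n x\<bar> powr p)"
        using K f by auto
      show "indicat_real K x *\<^sub>R \<bar>f n x\<bar> \<le> e * indicat_real K x + e powr (1 - p) * \<bar>f n x\<bar> powr p" for x
        using abs_le_powr_bound[OF e p, of "f n x"] by (auto simp: indicator_def)
    qed
    also have "\<dots> = e * measure M K + e powr (1 - p) * (\<integral>x. \<bar>f n x\<bar> powr p \<partial>M)"
      using K f by simp
    finally have "(LINT x:K|M. \<bar>f n x\<bar>) < r" using less by simp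
    moreover have "0 \<le> (LINT x:K|M. \<bar>f n x\<bar>)"
      unfolding set_lebesgue_integral_def by (rule integral_nonneg_AE) auto
    ultimately show "dist (LINT x:K|M. \<bar>f n x\<bar>) 0 < r" by simp
  qed
qed

section \<open>Calculus of iterated partial derivatives\<close>

lemma pdiff_eqI:
  "((\<lambda>t. f (x + t *\<^sub>R axis i 1)) has_real_derivative D) (at 0) \<Longrightarrow> pdiff i f x = D"
  unfolding pdiff_def by (rule DERIV_imp_deriv)

lemma eventually_along_axis:
  fixes x :: "real^'n::finite"
  assumes "open S" "x \<in> S"
  shows "eventually (\<lambda>t. x + t *\<^sub>R axis i 1 \<in> S) (nhds (0::real))"
proof -
  have "((\<lambda>t. x + t *\<^sub>R axis i 1) \<longlongrightarrow> x + 0 *\<^sub>R axis i 1) (nhds (0::real))"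
    by (intro tendsto_intros filterlim_ident)
  then show ?thesis
    using assms by (auto dest: topological_tendstoD)
qed

lemma has_partial_cong:
  fixes x :: "real^'n::finite"
  assumes "open S" "x \<in> S" "\<And>y. y \<in> S \<Longrightarrow> f y = g y"
  shows "((\<lambda>t. f (x + t *\<^sub>R axis i 1)) has_real_derivative D) (at 0) \<longleftrightarrow>
    ((\<lambda>t. g (x + t *\<^sub>R axis i 1)) has_real_derivative D) (at 0)"
  using eventually_along_axis[OF assms(1,2), of i]
  by (intro DERIV_cong_ev) (auto elim!: eventually_mono simp: assms(3))

lemma pdiff_cong:
  fixes x :: "real^'n::finite"
  assumes "open S" "x \<in> S" "\<And>y. y \<in> S \<Longrightarrow> f y = g y"
  shows "pdiff i f x = pdiff i g x"
  unfolding pdiff_def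
  using eventually_along_axis[OF assms(1,2), of i]
  by (intro deriv_cong_ev) (auto elim!: eventually_mono simp: assms(3))

lemma pdiffs_cong:
  fixes x :: "real^'n::finite"
  assumes "open S" "x \<in> S" "\<And>y. y \<in> S \<Longrightarrow> f y = g y"
  shows "pdiffs is f x = pdiffs is g x"
  using assms(2)
proof (induction "is" arbitrary: x)
  case (Cons i "is")
  then show ?case by (auto intro!: pdiff_cong[OF assms(1)])
qed (simp add: assms(3))

lemma pdiffs_snoc: "pdiffs (is @ [i]) f = pdiffs is (pdiff i f)"
  by (induction "is") auto

lemma pdiffs_zero: "pdiffs is (\<lambda>_. 0) = (\<lambda>_. 0)"
  by (induction "is") (auto simp: pdiff_def)

lemma Ck_on_0: "Ck_on 0 \<Omega> f \<longleftrightarrow> continuous_on \<Omega> f"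
  by (auto simp: Ck_on_def)

text \<open>\<open>Ck_on\<close> quantifies over words of partial derivatives whose last letter acts
  first. Splitting off that innermost derivative gives a recursion on \<open>k\<close>, on which the
  inductions for sums, products and bumps run.\<close>

lemma Ck_on_Suc:
  "Ck_on (Suc k) \<Omega> f \<longleftrightarrow> continuous_on \<Omega> f \<and>
    (\<forall>i. (\<forall>x\<in>\<Omega>. ((\<lambda>t. f (x + t *\<^sub>R axis i 1)) has_real_derivative pdiff i f x) (at 0)) \<and>
      Ck_on k \<Omega> (pdiff i f))" (is "?L \<longleftrightarrow> ?R")
proof
  assume L: ?L
  show ?R
  proof (intro conjI allI)
    show "continuous_on \<Omega> f" using L by (auto simp: Ck_on_def dest: spec[of _ "[]"])
    fix i
    show "\<forall>x\<in>\<Omega>. ((\<lambda>t. f (x + t *\<^sub>R axis i 1)) has_real_derivative pdiff i f x) (at 0)"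
      using L[unfolded Ck_on_def, THEN conjunct2, THEN spec[of _ "[]"]] by auto
    show "Ck_on k \<Omega> (pdiff i f)"
      unfolding Ck_on_def
    proof (intro conjI allI impI)
      fix "is" :: "'a list" assume "length is \<le> k"
      then show "continuous_on \<Omega> (pdiffs is (pdiff i f))"
        using L[unfolded Ck_on_def, THEN conjunct1, THEN spec[of _ "is @ [i]"]] by (simp add: pdiffs_snoc)
    next
      fix "is" :: "'a list" and j assume "length is < k"
      then show "\<forall>x\<in>\<Omega>. ((\<lambda>t. pdiffs is (pdiff i f) (x + t *\<^sub>R axis j 1)) has_real_derivative
                pdiffs (j # is) (pdiff i f) x) (at 0)"
        using L[unfolded Ck_on_def, THEN conjunct2, THEN spec[of _ "is @ [i]"]] by (simp add: pdiffs_snoc)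
    qed
  qed
next
  assume R: ?R
  show ?L
    unfolding Ck_on_def
  proof (intro conjI allI impI)
    fix "is" :: "'a list" assume "length is \<le> Suc k"
    then show "continuous_on \<Omega> (pdiffs is f)"
      using R by (cases "is" rule: rev_cases) (auto simp: pdiffs_snoc Ck_on_def)
  next
    fix "is" :: "'a list" and j assume "length is < Suc k"
    then show "\<forall>x\<in>\<Omega>. ((\<lambda>t. pdiffs is f (x + t *\<^sub>R axis j 1)) has_real_derivative
                pdiffs (j # is) f x) (at 0)"
      using R by (cases "is" rule: rev_cases) (auto simp: pdiffs_snoc Ck_on_def)
  qed
qed

lemma Ck_on_mono: "Ck_on k \<Omega> f \<Longrightarrow> j \<le> k \<Longrightarrow> Ck_on j \<Omega> f"
  by (auto simp: Ck_on_def)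

lemma Ck_on_subset: "Ck_on k \<Omega> f \<Longrightarrow> S \<subseteq> \<Omega> \<Longrightarrow> Ck_on k S f"
  unfolding Ck_on_def using continuous_on_subset by blast

lemma Ck_on_imp_continuous_on: "Ck_on k \<Omega> f \<Longrightarrow> continuous_on \<Omega> f"
  by (cases k) (auto simp: Ck_on_0 Ck_on_Suc)

lemma Ck_on_cong:
  assumes "open \<Omega>" "\<And>x. x \<in> \<Omega> \<Longrightarrow> f x = g x" "Ck_on k \<Omega> f"
  shows "Ck_on k \<Omega> g"
  using assms(2,3)
proof (induction k arbitrary: f g)
  case 0
  then show ?case using continuous_on_cong[of \<Omega> \<Omega> f g] by (simp add: Ck_on_0)
next
  case (Suc k)
  have eq: "pdiff i f x = pdiff i g x" if "x \<in> \<Omega>" for i x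
    using assms(1) that Suc.prems(1) by (rule pdiff_cong)
  note C = Suc.prems(2)[unfolded Ck_on_Suc]
  have "continuous_on \<Omega> g"
    using C continuous_on_cong[of \<Omega> \<Omega> f g] Suc.prems(1) by simp
  moreover have "Ck_on k \<Omega> (pdiff i g)" for i
    by (rule Suc.IH[of "pdiff i f"]) (use C eq in auto)
  moreover have "((\<lambda>t. g (x + t *\<^sub>R axis i 1)) has_real_derivative pdiff i g x) (at 0)"
    if x: "x \<in> \<Omega>" for i x
  proof -
    have "((\<lambda>t. f (x + t *\<^sub>R axis i 1)) has_real_derivative pdiff i f x) (at 0)"
      using C x by blast
    then show ?thesis
      using has_partial_cong[OF assms(1) x Suc.prems(1), of "\<lambda>y. y" i "pdiff i f x"] eq[OF x]
      by simp
  qed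
  ultimately show ?case
    unfolding Ck_on_Suc by blast
qed

text \<open>Allows the partials to be given by an explicit formula \<open>g i\<close>. It agrees
  with \<open>pdiff i f\<close> only on the domain, which is enough because derivatives at points of
  an open set depend on values there alone.\<close>

lemma Ck_on_SucI:
  assumes "open \<Omega>" "continuous_on \<Omega> f"
    and "\<And>i x. x \<in> \<Omega> \<Longrightarrow> ((\<lambda>t. f (x + t *\<^sub>R axis i 1)) has_real_derivative g i x) (at 0)"
    and "\<And>i. Ck_on k \<Omega> (g i)"
  shows "Ck_on (Suc k) \<Omega> f"
  unfolding Ck_on_Suc
proof (intro conjI allI ballI)
  have eq: "pdiff i f x = g i x" if "x \<in> \<Omega>" for i x
    using assms(3)[OF that] by (rule pdiff_eqI)
  show "((\<lambda>t. f (x + t *\<^sub>R axis i 1)) has_real_derivative pdiff i f x) (at 0)" if "x \<in> \<Omega>" for i x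
    using assms(3)[OF that] eq[OF that] by simp
  show "Ck_on k \<Omega> (pdiff i f)" for i
    using assms(1) _ assms(4) by (rule Ck_on_cong) (simp add: eq)
qed fact

lemma Ck_on_partial:
  "Ck_on (Suc k) \<Omega> f \<Longrightarrow> x \<in> \<Omega> \<Longrightarrow>
    ((\<lambda>t. f (x + t *\<^sub>R axis i 1)) has_real_derivative pdiff i f x) (at 0)"
  by (simp add: Ck_on_Suc)

lemma Ck_on_pdiff: "Ck_on (Suc k) \<Omega> f \<Longrightarrow> Ck_on k \<Omega> (pdiff i f)"
  by (simp add: Ck_on_Suc)

lemma Ck_on_const: "open \<Omega> \<Longrightarrow> Ck_on k \<Omega> (\<lambda>_. c)"
proof (induction k arbitrary: c)
  case (Suc k)
  then show ?case by (intro Ck_on_SucI[where g="\<lambda>_ _. 0"]) auto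
qed (simp add: Ck_on_0)

lemma Ck_on_add:
  assumes "open \<Omega>" "Ck_on k \<Omega> f" "Ck_on k \<Omega> g"
  shows "Ck_on k \<Omega> (\<lambda>x. f x + g x)"
  using assms(2,3)
proof (induction k arbitrary: f g)
  case 0
  then show ?case by (simp add: Ck_on_0 continuous_on_add)
next
  case (Suc k)
  show ?case
  proof (rule Ck_on_SucI[where g="\<lambda>i x. pdiff i f x + pdiff i g x"])
    show "continuous_on \<Omega> (\<lambda>x. f x + g x)"
      by (intro continuous_on_add Suc.prems[THEN Ck_on_imp_continuous_on])
    show "Ck_on k \<Omega> (\<lambda>x. pdiff i f x + pdiff i g x)" for i
      by (intro Suc.IH Suc.prems[THEN Ck_on_pdiff])
  qed (intro assms(1) DERIV_add Suc.prems[THEN Ck_on_partial] | assumption)+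
qed

lemma has_partial_mult:
  assumes "((\<lambda>t. f (x + t *\<^sub>R axis i 1)) has_real_derivative a) (at 0)"
    "((\<lambda>t. g (x + t *\<^sub>R axis i 1)) has_real_derivative b) (at 0)"
  shows "((\<lambda>t. f (x + t *\<^sub>R axis i 1) * g (x + t *\<^sub>R axis i 1)) has_real_derivative
    a * g x + f x * b) (at 0)"
  using DERIV_mult[OF assms] by (simp add: algebra_simps)

lemma Ck_on_mult:
  assumes "open \<Omega>" "Ck_on k \<Omega> f" "Ck_on k \<Omega> g"
  shows "Ck_on k \<Omega> (\<lambda>x. f x * g x)"
  using assms(2,3)
proof (induction k arbitrary: f g)
  case 0
  then show ?case by (simp add: Ck_on_0 continuous_on_mult)
next
  case (Suc k)
  show ?case
  proof (rule Ck_on_SucI[where g="\<lambda>i x. pdiff i f x * g x + f x * pdiff i g x"])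
    show "continuous_on \<Omega> (\<lambda>x. f x * g x)"
      by (intro continuous_on_mult Suc.prems[THEN Ck_on_imp_continuous_on])
    show "Ck_on k \<Omega> (\<lambda>x. pdiff i f x * g x + f x * pdiff i g x)" for i
      by (intro Ck_on_add Suc.IH assms(1) Suc.prems[THEN Ck_on_pdiff] Suc.prems[THEN Ck_on_mono]) simp_all
  qed (intro assms(1) has_partial_mult Suc.prems[THEN Ck_on_partial] | assumption)+
qed

lemma Ck_on_prod:
  assumes "open \<Omega>" "finite I" "\<And>i. i \<in> I \<Longrightarrow> Ck_on k \<Omega> (f i)"
  shows "Ck_on k \<Omega> (\<lambda>x. \<Prod>i\<in>I. f i x)"
  using assms(2,3) by (induction I) (auto intro: Ck_on_const Ck_on_mult assms(1))


text \<open>Each differentiation costs at most one factor of \<open>v\<close>, so fewer than \<open>n\<close>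
  differentiations leave one factor intact.\<close>

lemma pdiffs_power_mult:
  assumes "open \<Omega>" "Ck_on k \<Omega> v" "Ck_on k \<Omega> \<phi>" "length is \<le> k" "length is \<le> n"
  shows "\<exists>R. Ck_on (k - length is) \<Omega> R \<and>
    (\<forall>x\<in>\<Omega>. pdiffs is (\<lambda>y. v y ^ n * \<phi> y) x = v x ^ (n - length is) * R x)"
  using assms(4,5)
proof (induction "is")
  case Nil
  then show ?case using assms by (auto intro!: exI[of _ \<phi>])
next
  case (Cons i "is")
  define j where "j = length is"
  have j: "Suc j \<le> k" "Suc j \<le> n" using Cons.prems by (auto simp: j_def)
  from Cons obtain R where R: "Ck_on (k - j) \<Omega> R"
    "\<And>x. x \<in> \<Omega> \<Longrightarrow> pdiffs is (\<lambda>y. v y ^ n * \<phi> y) x = v x ^ (n - j) * R x"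
    by (auto simp: j_def)
  have kj: "k - j = Suc (k - Suc j)" and nj: "n - j = Suc (n - Suc j)"
    using j by auto
  have v: "Ck_on (Suc (k - Suc j)) \<Omega> v"
    using assms(2) by (rule Ck_on_mono) (use j in auto)
  note R1 = R(1)[unfolded kj]
  \<comment> \<open>By the product rule, \<open>v ^ (n - j) * R\<close> has the partial derivative
    \<open>v ^ (n - Suc j) * R'\<close>. Differentiating \<open>R\<close> costs it one order of
    smoothness.\<close>
  define R' where "R' x = of_nat (n - j) * (pdiff i v x * R x) + v x * pdiff i R x" for x
  have "Ck_on (k - Suc j) \<Omega> R'"
    unfolding R'_def
    by (intro Ck_on_add Ck_on_mult Ck_on_const assms(1) Ck_on_pdiff v R1)
      (rule Ck_on_mono[OF R1] Ck_on_mono[OF v], simp)+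
  moreover have "pdiffs (i # is) (\<lambda>y. v y ^ n * \<phi> y) x = v x ^ (n - Suc j) * R' x" if x: "x \<in> \<Omega>" for x
  proof -
    have "pdiffs (i # is) (\<lambda>y. v y ^ n * \<phi> y) x = pdiff i (\<lambda>x. v x ^ (n - j) * R x) x"
      by simp (rule pdiff_cong[OF assms(1) x], simp add: R(2))
    also have "\<dots> = of_nat (n - j) * pdiff i v x * v x ^ (n - Suc j) * R x + v x ^ (n - j) * pdiff i R x"
      by (intro pdiff_eqI has_partial_mult Ck_on_partial[OF R1 x]
          DERIV_cong[OF DERIV_power[OF Ck_on_partial[OF v x]]]) (simp add: nj)
    also have "\<dots> = v x ^ (n - Suc j) * R' x"
      by (simp add: R'_def nj algebra_simps)
    finally show ?thesis .
  qed
  ultimately show ?case unfolding j_def list.size add_0 add_Suc_right by auto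
qed

lemma mlen_enum: "length (concat (map (\<lambda>i. replicate (\<alpha> i) i) enum_idx)) = mlen \<alpha>"
proof -
  have "\<exists>xs::'a list. distinct xs \<and> set xs = UNIV"
    using finite_distinct_list[of "UNIV::'a set"] by auto
  then have "distinct (enum_idx::'a list) \<and> set (enum_idx::'a list) = UNIV"
    unfolding enum_idx_def by (rule someI_ex)
  moreover have "length (concat (map (\<lambda>i. replicate (\<alpha> i) i) xs)) = sum_list (map \<alpha> xs)" for xs
    by (induction xs) auto
  ultimately show ?thesis
    unfolding mlen_def by (metis sum_list_distinct_conv_sum_set)
qed

section \<open>Smooth bump functions and du Bois-Reymond's lemma\<close>

text \<open>The classical \<open>exp (-1/s)\<close> is \<open>bump 0\<close>. The extra powers of
  \<open>1/s\<close> make the family closed under differentiation up to linear combinations, so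
  smoothness follows by induction on the order for all \<open>j\<close> simultaneously.\<close>

definition bump :: "nat \<Rightarrow> real \<Rightarrow> real" where
  "bump j s = (if 0 < s then exp (- (1 / s)) * (1 / s) ^ j else 0)"

lemma bump_tendsto_0: "(bump j \<longlongrightarrow> 0) (at 0)"
proof -
  \<comment> \<open>Substituting \<open>y = 1/s\<close> turns this into the decay of
    \<open>y ^ j * exp (- y)\<close> at infinity.\<close>
  have "((\<lambda>s. exp (- (inverse s)) * inverse s ^ j) \<longlongrightarrow> 0) (at_right (0::real))"
  proof (rule filterlim_compose[OF _ filterlim_inverse_at_top_right])
    show "((\<lambda>y. exp (- y) * y ^ j) \<longlongrightarrow> 0) (at_top :: real filter)"
      using tendsto_power_div_exp_0[of j] by (simp add: exp_minus field_simps)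
  qed
  then have "(bump j \<longlongrightarrow> 0) (at_right 0)"
    by (rule Lim_transform_eventually)
      (auto simp: bump_def eventually_at_filter inverse_eq_divide)
  moreover have "(bump j \<longlongrightarrow> 0) (at_left 0)"
    by (rule Lim_transform_eventually[OF tendsto_const]) (auto simp: bump_def eventually_at_filter)
  ultimately show ?thesis
    by (simp add: filterlim_at_split)
qed

lemma bump_has_derivative:
  "(bump j has_real_derivative bump (j + 2) s - of_nat j * bump (j + 1) s) (at s)"
proof -
  consider "s < 0" | "s = 0" | "s > 0" by linarith
  then show ?thesis
  proof cases
    case 1
    have "((\<lambda>_. 0) has_real_derivative 0) (at s)" by simp
    then have "(bump j has_real_derivative 0) (at s)"
      by (rule has_field_derivative_transform_within_open[of _ _ _ "{..<0}"]) (use 1 in \<open>auto simp: bump_def\<close>)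
    then show ?thesis using 1 by (simp add: bump_def)
  next
    case 2
    \<comment> \<open>The difference quotient at 0 is again a member of the family,
      \<open>bump (Suc j) h\<close>, so its limit is already known.\<close>
    have "((\<lambda>h. (bump j (0 + h) - bump j 0) / h) \<longlongrightarrow> 0) (at 0)"
      by (rule Lim_transform_eventually[OF bump_tendsto_0[of "Suc j"]])
        (auto simp: bump_def eventually_at_filter)
    then show ?thesis using 2 by (simp add: DERIV_def) (simp add: bump_def)
  next
    case 3
    have "((\<lambda>s. exp (- (1 / s)) * (1 / s) ^ j) has_real_derivative
        bump (j + 2) s - of_nat j * bump (j + 1) s) (at s)"
    proof -
      have inv: "((\<lambda>s. 1 / s) has_real_derivative - ((1 / s)\<^sup>2)) (at s)"
        using 3 DERIV_inverse[of s UNIV] by (simp add: inverse_eq_divide power_one_over numeral_2_eq_2)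
      have "((\<lambda>s. exp (- (1 / s)) * (1 / s) ^ j) has_real_derivative
          exp (- (1 / s)) * - (- ((1 / s)\<^sup>2)) * (1 / s) ^ j +
          of_nat j * (- ((1 / s)\<^sup>2) * (1 / s) ^ (j - Suc 0)) * exp (- (1 / s))) (at s)"
        by (rule DERIV_mult[OF DERIV_chain2[OF DERIV_exp DERIV_minus[OF inv]] DERIV_power[OF inv]])
      also have "exp (- (1 / s)) * - (- ((1 / s)\<^sup>2)) * (1 / s) ^ j +
          of_nat j * (- ((1 / s)\<^sup>2) * (1 / s) ^ (j - Suc 0)) * exp (- (1 / s)) =
          bump (j + 2) s - of_nat j * bump (j + 1) s"
        using 3 by (cases j) (simp_all add: bump_def power2_eq_square algebra_simps)
      finally show ?thesis .
    qed
    then show ?thesis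
      by (rule has_field_derivative_transform_within_open[of _ _ _ "{0<..}"]) (use 3 in \<open>auto simp: bump_def\<close>)
  qed
qed

lemma Ck_on_bump_coord: "Ck_on k UNIV (\<lambda>x::real^'n::finite. bump j (c * (x $ i) + d))"
proof (induction k arbitrary: j)
  have "continuous_on UNIV (bump j)" for j
    using bump_has_derivative by (auto intro!: continuous_at_imp_continuous_on DERIV_isCont)
  then have cont: "continuous_on UNIV (\<lambda>x::real^'n. bump j (c * (x $ i) + d))" for j
    by (rule continuous_on_compose2) (auto intro!: continuous_intros)
  {
    case 0
    show ?case using cont by (simp add: Ck_on_0)
  next
    case (Suc k)
    define e where "e i' = c * (if i' = i then 1 else 0)" for i'
    show ?case
    proof (rule Ck_on_SucI[where g="\<lambda>i' x. (bump (j + 2) (c * (x $ i) + d) + (- of_nat j) * bump (j + 1) (c * (x $ i) + d)) * e i'"])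
      fix i' and x :: "real^'n"
      have "((\<lambda>t. c * ((x + t *\<^sub>R axis i' 1) $ i) + d) has_real_derivative e i') (at 0)"
        by (auto simp: axis_def e_def intro!: derivative_eq_intros)
      from DERIV_chain2[OF bump_has_derivative this, of j]
      show "((\<lambda>t. bump j (c * ((x + t *\<^sub>R axis i' 1) $ i) + d)) has_real_derivative
          (bump (j + 2) (c * (x $ i) + d) + (- of_nat j) * bump (j + 1) (c * (x $ i) + d)) * e i') (at 0)"
        by simp
      show "Ck_on k UNIV (\<lambda>x::real^'n. (bump (j + 2) (c * (x $ i) + d) + (- of_nat j) * bump (j + 1) (c * (x $ i) + d)) * e i')"
        by (intro Ck_on_add Ck_on_mult Ck_on_const Suc.IH open_UNIV)
    qed (use cont in auto)
  }
qed

lemma bump_0_bounds: "0 \<le> bump 0 s" "bump 0 s \<le> 1" "0 < bump 0 s \<longleftrightarrow> 0 < s"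
  by (auto simp: bump_def)

lemma bump_0_tendsto: "(\<lambda>n. bump 0 (real n * s)) \<longlonglongrightarrow> (if 0 < s then 1 else 0)"
proof (cases "0 < s")
  case True
  have "(\<lambda>n. exp (- (inverse (real n) * (1 / s)))) \<longlonglongrightarrow> exp (- (0 * (1 / s)))"
    by (intro tendsto_intros lim_inverse_n)
  then have "(\<lambda>n. exp (- (inverse (real n) * (1 / s)))) \<longlonglongrightarrow> 1"
    by simp
  then have "(\<lambda>n. bump 0 (real n * s)) \<longlonglongrightarrow> 1"
    by (rule Lim_transform_eventually)
      (use True in \<open>auto simp: bump_def inverse_eq_divide intro!: eventually_sequentiallyI[of 1]\<close>)
  then show ?thesis using True by simp
next
  case False
  then have "\<not> 0 < real n * s" for n by (auto simp: zero_less_mult_iff)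
  with False show ?thesis by (simp add: bump_def)
qed

text \<open>Smooth functions tending pointwise to the indicator of the open box. The factor
  \<open>n\<close> steepens the flanks and leaves the support inside \<open>cbox a b\<close>, so
  every member is a test function as soon as that closed box lies in the domain.\<close>

definition box_bump :: "real^'n::finite \<Rightarrow> real^'n \<Rightarrow> nat \<Rightarrow> real^'n \<Rightarrow> real" where
  "box_bump a b n x = (\<Prod>i\<in>UNIV. bump 0 (n * (x $ i - a $ i)) * bump 0 (n * (b $ i - x $ i)))"

lemma Ck_on_box_bump: "Ck_on k UNIV (box_bump a b n)"
proof -
  have "box_bump a b n = (\<lambda>x. \<Prod>i\<in>UNIV. bump 0 (n * (x $ i) + - n * a $ i) * bump 0 (- n * (x $ i) + n * b $ i))"
    by (simp add: box_bump_def fun_eq_iff algebra_simps)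
  moreover have "Ck_on k UNIV (\<lambda>x. \<Prod>i\<in>UNIV. bump 0 (n * (x $ i) + - n * a $ i) * bump 0 (- n * (x $ i) + n * b $ i))"
    by (intro Ck_on_prod Ck_on_mult Ck_on_bump_coord open_UNIV finite)
  ultimately show ?thesis by simp
qed

lemma box_bump_bounds: "0 \<le> box_bump a b n x" "box_bump a b n x \<le> 1"
  unfolding box_bump_def
  by (auto intro!: prod_nonneg prod_le_1 mult_le_one simp: bump_0_bounds)

lemma box_bump_eq_0:
  assumes "x \<notin> box a b"
  shows "box_bump a b n x = 0"
proof -
  from assms obtain i where "\<not> (a $ i < x $ i \<and> x $ i < b $ i)"
    by (auto simp: mem_box_cart)
  then have "bump 0 (n * (x $ i - a $ i)) * bump 0 (n * (b $ i - x $ i)) = 0"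
    by (auto simp: bump_def zero_less_mult_iff)
  then show ?thesis by (auto simp: box_bump_def intro!: prod_zero)
qed

lemma box_bump_tendsto: "(\<lambda>n. box_bump a b n x) \<longlonglongrightarrow> indicator (box a b) x"
proof (cases "x \<in> box a b")
  case True
  then have "(\<lambda>n. box_bump a b n x) \<longlonglongrightarrow> (\<Prod>i\<in>UNIV. (if 0 < x $ i - a $ i then 1 else 0) * (if 0 < b $ i - x $ i then 1 else 0))"
    unfolding box_bump_def by (intro tendsto_intros bump_0_tendsto)
  then show ?thesis using True by (simp add: mem_box_cart)
qed (simp add: box_bump_eq_0)

lemma test_fun_box_bump:
  assumes "cbox a b \<subseteq> \<Omega>"
  shows "test_fun \<Omega> (box_bump a b n)"
proof -
  have "{x. box_bump a b n x \<noteq> 0} \<subseteq> cbox a b"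
    using box_bump_eq_0 box_subset_cbox by fast
  then have "closure {x. box_bump a b n x \<noteq> 0} \<subseteq> cbox a b"
    by (intro closure_minimal) auto
  with assms show ?thesis
    using bounded_subset[OF bounded_cbox, of "{x. box_bump a b n x \<noteq> 0}" a b]
      \<open>{x. box_bump a b n x \<noteq> 0} \<subseteq> cbox a b\<close>
    unfolding test_fun_def by (auto simp: Ck_on_box_bump)
qed

section \<open>Functions determined by their integrals\<close>

text \<open>Open boxes are stable under intersection and generate the Borel sets, so vanishing
  integrals spread from boxes to all Borel sets by Dynkin's argument; a function with this property
  is zero almost everywhere.\<close>

lemma AE_zero_if_box_integrals_zero:
  fixes f :: "'a::euclidean_space \<Rightarrow> real"
  assumes int: "integrable lebesgue f" and UNIV: "(LINT x|lebesgue. f x) = 0"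
    and box: "\<And>a b. (LINT x:box a b|lebesgue. f x) = 0"
  shows "AE x in lebesgue. f x = 0"
proof -
  have "f \<in> borel_measurable lebesgue" using int by simp
  \<comment> \<open>Boxes generate the Borel sets but not their completion, so the induction has to
    run with a Borel version of \<open>f\<close>.\<close>
  then obtain f' where f'[measurable]: "f' \<in> borel_measurable lborel" and ae: "AE x in lborel. f x = f' x"
    using completion_ex_borel_measurable_real by blast
  have ae': "AE x in lebesgue. f x = f' x"
    using ae by (rule AE_completion)
  have int': "integrable lborel f'"
    using int integrable_cong_AE[of f lebesgue f'] ae' f' integrable_completion[of f' lborel] by (auto simp: measurable_completion)
  have tr: "(LINT x:A|lborel. f' x) = (LINT x:A|lebesgue. f x)" if "A \<in> sets borel" for A
  proof -
    have "(LINT x:A|lborel. f' x) = (LINT x:A|lebesgue. f' x)"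
      unfolding set_lebesgue_integral_def using that by (subst integral_completion) auto
    also have "\<dots> = (LINT x:A|lebesgue. f x)"
      unfolding set_lebesgue_integral_def
    proof (rule integral_cong_AE)
      have A[measurable]: "A \<in> sets lebesgue" and [measurable]: "f \<in> borel_measurable lebesgue"
        and [measurable]: "f' \<in> borel_measurable lebesgue"
        using that int f' by (auto simp: measurable_completion)
      show "(\<lambda>x. indicat_real A x *\<^sub>R f' x) \<in> borel_measurable lebesgue"
        "(\<lambda>x. indicat_real A x *\<^sub>R f x) \<in> borel_measurable lebesgue"
        by measurable
    qed (use ae' in auto)
    finally show ?thesis .
  qed
  have "(LINT x:A|lborel. f' x) = 0" if A: "A \<in> sets borel" for A
  proof -
    have "Int_stable (range (\<lambda>(a, b). box a b :: 'a set))"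
      by (auto simp: Int_stable_def box_Int_box)
    moreover have "(range (\<lambda>(a, b). box a b :: 'a set)) \<subseteq> Pow UNIV"
      by auto
    moreover have "A \<in> sigma_sets UNIV (range (\<lambda>(a, b). box a b))"
      using A unfolding borel_eq_box by simp
    ultimately show ?thesis
    proof (induction rule: sigma_sets_induct_disjoint)
      case (basic A)
      then show ?case using box tr by auto
    next
      case empty
      then show ?case by (simp add: set_lebesgue_integral_def)
    next
      case (compl A)
      then have [measurable]: "A \<in> sets borel" by (simp add: borel_eq_box)
      \<comment> \<open>Complements are where the vanishing of the total integral enters.\<close>
      have "(LINT x:UNIV|lborel. f' x) = (LINT x:A|lborel. f' x) + (LINT x:UNIV - A|lborel. f' x)"
        using int' integrable_mult_indicator[of _ lborel f']
        by (subst set_integral_Un[symmetric]) (auto simp: set_integrable_def)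
      moreover have "(LINT x:UNIV|lborel. f' x) = 0"
        using tr[of UNIV] UNIV by (simp add: set_lebesgue_integral_def)
      ultimately show ?case using compl by simp
    next
      case (union A)
      then have [measurable]: "A i \<in> sets borel" for i by (auto simp: borel_eq_box)
      have "(LINT x:(\<Union>i. A i)|lborel. f' x) = (\<Sum>i. LINT x:A i|lborel. f' x)"
        using union int' integrable_mult_indicator[of _ lborel f']
        by (intro lebesgue_integral_countable_add) (auto simp: set_integrable_def disjoint_family_on_def)
      then show ?case using union by simp
    qed
  qed
  then have "AE x in lborel. f' x = 0"
    using density_unique_real[OF int', of "\<lambda>_. 0"] by simp
  then have "AE x in lebesgue. f' x = 0" by (rule AE_completion)
  with ae' show ?thesis by auto
qed

text \<open>Testing with \<open>box_bump\<close> and letting \<open>n\<close> grow gives zero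
  integrals over open boxes whose closed boxes lie in the domain. Cutting \<open>h\<close> off to
  such a box makes it globally integrable, so that the preceding lemma applies; countably many
  closed boxes then exhaust the domain.\<close>

lemma du_Bois_Reymond:
  fixes h :: "real^'n::finite \<Rightarrow> real"
  assumes \<Omega>: "open \<Omega>"
    and int: "\<And>K. compact K \<Longrightarrow> K \<subseteq> \<Omega> \<Longrightarrow> set_integrable lebesgue K h"
    and zero: "\<And>\<phi>. test_fun \<Omega> \<phi> \<Longrightarrow> (LINT x:\<Omega>|lebesgue. \<phi> x * h x) = 0"
  shows "AE x in lebesgue. x \<in> \<Omega> \<longrightarrow> h x = 0"
proof -
  have box: "(LINT x:box a b|lebesgue. h x) = 0" if sub: "cbox a b \<subseteq> \<Omega>" for a b
  proof -
    have I: "integrable lebesgue (\<lambda>x. indicator (cbox a b) x * h x)"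
      using int[OF compact_cbox sub] by (simp add: set_integrable_def)
    have Ib: "integrable lebesgue (\<lambda>x. indicator (box a b) x * h x)"
      using set_integrable_subset[OF int[OF compact_cbox sub], of "box a b"] box_subset_cbox[of a b]
      by (simp add: set_integrable_def)
    \<comment> \<open>The cutoff to the closed box changes nothing where the bump lives, and it
      provides the integrable majorant for dominated convergence.\<close>
    have bb: "box_bump a b n x * (indicator (cbox a b) x * h x) = indicator \<Omega> x * (box_bump a b n x * h x)" for n x
      using box_bump_eq_0[of x a b n] sub box_subset_cbox[of a b] by (cases "x \<in> box a b") (auto simp: indicator_def)
    have meas: "box_bump a b n \<in> borel_measurable lebesgue" for n
      using Ck_on_imp_continuous_on[OF Ck_on_box_bump[of 0 a b n]]
      by (intro measurable_completion) (auto intro: borel_measurable_continuous_onI)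
    have "(\<lambda>n. LINT x|lebesgue. box_bump a b n x * (indicator (cbox a b) x * h x)) \<longlonglongrightarrow>
        (LINT x|lebesgue. indicator (box a b) x * h x)"
    proof (rule integral_dominated_convergence)
      show "integrable lebesgue (\<lambda>x. \<bar>indicator (cbox a b) x * h x\<bar>)" using I by simp
      show "AE x in lebesgue. (\<lambda>n. box_bump a b n x * (indicator (cbox a b) x * h x)) \<longlonglongrightarrow> indicator (box a b) x * h x"
      proof (rule AE_I2)
        fix x
        have "(\<lambda>n. box_bump a b n x * (indicator (cbox a b) x * h x)) \<longlonglongrightarrow> indicator (box a b) x * (indicator (cbox a b) x * h x)"
          by (intro tendsto_intros box_bump_tendsto)
        then show "(\<lambda>n. box_bump a b n x * (indicator (cbox a b) x * h x)) \<longlonglongrightarrow> indicator (box a b) x * h x"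
          using box_subset_cbox[of a b] by (cases "x \<in> box a b") (auto simp: indicator_def)
      qed
      show "AE x in lebesgue. norm (box_bump a b n x * (indicator (cbox a b) x * h x)) \<le> \<bar>indicator (cbox a b) x * h x\<bar>" for n
        using box_bump_bounds[of a b n] by (auto simp: abs_mult intro!: mult_left_le_one_le)
    qed (use I Ib meas in auto)
    moreover have "(LINT x|lebesgue. box_bump a b n x * (indicator (cbox a b) x * h x)) = 0" for n
      using zero[OF test_fun_box_bump[OF sub, of n]] unfolding bb by (simp add: set_lebesgue_integral_def)
    ultimately show ?thesis
      by (simp add: LIMSEQ_const_iff set_lebesgue_integral_def)
  qed
  have ae: "AE x in lebesgue. x \<in> cbox a b \<longrightarrow> h x = 0" if sub: "cbox a b \<subseteq> \<Omega>" for a b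
  proof -
    have "AE x in lebesgue. indicator (box a b) x * h x = 0"
    proof (rule AE_zero_if_box_integrals_zero)
      show "integrable lebesgue (\<lambda>x. indicator (box a b) x * h x)"
        using set_integrable_subset[OF int[OF compact_cbox sub], of "box a b"] box_subset_cbox[of a b]
        by (simp add: set_integrable_def)
      show "(LINT x|lebesgue. indicator (box a b) x * h x) = 0"
        using box[OF sub] by (simp add: set_lebesgue_integral_def)
      fix c d :: "real^'n"
      obtain a' b' where ab: "box a b \<inter> box c d = box a' b'"
        using box_Int_box[of a b c d] by blast
      \<comment> \<open>Corners can be compared only for a nonempty box, whose closure is the closed
        box; an empty one does not determine \<open>a'\<close> and \<open>b'\<close>, but the
        integral over it is trivially zero.\<close>
      have ab': "cbox a' b' \<subseteq> cbox a b" if "box a' b' \<noteq> {}"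
      proof -
        have "closure (box a' b') \<subseteq> closure (box a b)"
          unfolding ab[symmetric] by (rule closure_mono) simp
        moreover have "box a b \<noteq> {}"
          using that ab by auto
        ultimately show ?thesis using that by (simp add: closure_box)
      qed
      have "(LINT x:box a' b'|lebesgue. h x) = 0"
        using ab' box[of a' b'] sub by (cases "box a' b' = {}") (auto simp: set_lebesgue_integral_def)
      moreover have "(LINT x:box c d|lebesgue. indicator (box a b) x * h x) = (LINT x:box a' b'|lebesgue. h x)"
        unfolding set_lebesgue_integral_def ab[symmetric] by (simp add: indicator_inter_arith mult_ac)
      ultimately show "(LINT x:box c d|lebesgue. indicator (box a b) x * h x) = 0" by simp
    qed
    \<comment> \<open>The faces of a box are null, which passes from the open box to the closed one
      used in the countable cover.\<close>
    moreover have "AE x in lebesgue. x \<notin> cbox a b - box a b"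
      using negligible_frontier_interval[of a b] by (intro AE_not_in) (simp add: negligible_iff_null_sets)
    ultimately show ?thesis
      by eventually_elim auto
  qed
  obtain D where D: "countable D" "D \<subseteq> Pow \<Omega>" "\<And>X. X \<in> D \<Longrightarrow> \<exists>a b. X = cbox a b" "\<Union>D = \<Omega>"
    using open_countable_Union_open_cbox[OF \<Omega>] by metis
  have "AE x in lebesgue. \<forall>X\<in>D. x \<in> X \<longrightarrow> h x = 0"
  proof (subst AE_ball_countable[OF D(1)], intro ballI)
    fix X assume "X \<in> D"
    with D(2,3) obtain a b where "X = cbox a b" "cbox a b \<subseteq> \<Omega>" by blast
    with ae show "AE x in lebesgue. x \<in> X \<longrightarrow> h x = 0" by simp
  qed
  then show ?thesis
    using D(4) by (auto elim!: eventually_mono)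
qed

section \<open>Weak derivatives and the weighted Sobolev space\<close>

lemma set_borel_measurable_mult:
  fixes f g :: "'a \<Rightarrow> real"
  assumes "set_borel_measurable M A f" "set_borel_measurable M A g"
  shows "set_borel_measurable M A (\<lambda>x. f x * g x)"
proof -
  have "(\<lambda>x. (indicator A x *\<^sub>R f x) * (indicator A x *\<^sub>R g x)) \<in> borel_measurable M"
    using assms unfolding set_borel_measurable_def by measurable
  also have "(\<lambda>x. (indicator A x *\<^sub>R f x) * (indicator A x *\<^sub>R g x)) = (\<lambda>x. indicator A x *\<^sub>R (f x * g x))"
    by (auto simp: indicator_def)
  finally show ?thesis unfolding set_borel_measurable_def .
qed

lemma set_borel_measurable_minus:
  fixes f g :: "'a \<Rightarrow> real"
  assumes "set_borel_measurable M A f" "set_borel_measurable M A g"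
  shows "set_borel_measurable M A (\<lambda>x. f x - g x)"
proof -
  have "(\<lambda>x. (indicator A x *\<^sub>R f x) - (indicator A x *\<^sub>R g x)) \<in> borel_measurable M"
    using assms unfolding set_borel_measurable_def by measurable
  then show ?thesis unfolding set_borel_measurable_def by (simp add: right_diff_distrib)
qed

lemma set_borel_measurable_lebesgue_continuous:
  fixes f :: "'a::euclidean_space \<Rightarrow> real"
  assumes "S \<in> sets borel" "continuous_on S f"
  shows "set_borel_measurable lebesgue S f"
  using borel_measurable_continuous_on_indicator[OF assms] unfolding set_borel_measurable_def
  by (intro measurable_completion) simp

lemma set_borel_measurable_mono:
  fixes f :: "'a \<Rightarrow> real"
  assumes "set_borel_measurable M A f" "B \<in> sets M" "B \<subseteq> A"
  shows "set_borel_measurable M B f"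
proof -
  have "(\<lambda>x. indicator B x * (indicator A x *\<^sub>R f x)) \<in> borel_measurable M"
    using assms unfolding set_borel_measurable_def by measurable
  also have "(\<lambda>x. indicator B x * (indicator A x *\<^sub>R f x)) = (\<lambda>x. indicator B x *\<^sub>R f x)"
    using assms(3) by (auto simp: fun_eq_iff indicator_def)
  finally show ?thesis unfolding set_borel_measurable_def .
qed

lemma compact_imp_lmeasurable_sets:
  fixes K :: "'a::euclidean_space set"
  assumes "compact K"
  shows "K \<in> sets lebesgue" "emeasure lebesgue K < \<infinity>"
  using lmeasurable_compact[OF assms] by (auto simp: fmeasurable_def)

section \<open>Integrals over compact sets against continuous factors\<close>

lemma set_integrable_continuous_mult:
  fixes f R :: "'a::euclidean_space \<Rightarrow> real"
  assumes K: "compact K" and R: "continuous_on K R" and f: "set_integrable lebesgue K f"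
  shows "set_integrable lebesgue K (\<lambda>x. R x * f x)"
proof -
  obtain B where B: "\<And>x. x \<in> K \<Longrightarrow> \<bar>R x\<bar> \<le> B"
    using compact_imp_bounded[OF compact_continuous_image[OF R K]] by (auto simp: bounded_iff)
  show ?thesis
    unfolding set_integrable_def
  proof (rule Bochner_Integration.integrable_bound)
    show "integrable lebesgue (\<lambda>x. B * (indicator K x *\<^sub>R f x))"
      using f unfolding set_integrable_def by simp
    have "set_borel_measurable lebesgue K (\<lambda>x. R x * f x)"
    proof (rule set_borel_measurable_mult)
      show "set_borel_measurable lebesgue K R"
        using R K by (intro set_borel_measurable_lebesgue_continuous borel_closed compact_imp_closed)
      show "set_borel_measurable lebesgue K f"
        using f unfolding set_integrable_def set_borel_measurable_def by simp
    qed
    then show "(\<lambda>x. indicat_real K x *\<^sub>R (R x * f x)) \<in> borel_measurable lebesgue"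
      unfolding set_borel_measurable_def .
    show "AE x in lebesgue. norm (indicat_real K x *\<^sub>R (R x * f x)) \<le> norm (B * (indicat_real K x *\<^sub>R f x))"
    proof (rule AE_I2)
      fix x
      show "norm (indicat_real K x *\<^sub>R (R x * f x)) \<le> norm (B * (indicat_real K x *\<^sub>R f x))"
      proof (cases "x \<in> K")
        case True
        then have "\<bar>R x\<bar> \<le> \<bar>B\<bar>" using B[of x] by simp
        then show ?thesis using True by (simp add: abs_mult mult_right_mono)
      qed simp
    qed
  qed
qed

text \<open>\<open>R\<close> is bounded on the compact set, so L1 convergence survives
  multiplication by it. Both sides of the weak derivative identity go to the limit in this way, with
  \<open>R\<close> the cofactor on one side and the test function on the other.\<close>

lemma tendsto_integral_continuous_mult:
  fixes f R :: "'a::euclidean_space \<Rightarrow> real"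
  assumes K: "compact K" and R: "continuous_on K R"
    and u: "\<And>n. set_integrable lebesgue K (u n)" and f: "set_integrable lebesgue K f"
    and lim: "(\<lambda>n. LINT x:K|lebesgue. \<bar>u n x - f x\<bar>) \<longlonglongrightarrow> 0"
  shows "(\<lambda>n. LINT x:K|lebesgue. R x * u n x) \<longlonglongrightarrow> (LINT x:K|lebesgue. R x * f x)"
proof -
  obtain B where B: "\<And>x. x \<in> K \<Longrightarrow> \<bar>R x\<bar> \<le> B"
    using compact_imp_bounded[OF compact_continuous_image[OF R K]] by (auto simp: bounded_iff)
  note I = set_integrable_continuous_mult[OF K R]
  have d: "set_integrable lebesgue K (\<lambda>x. u n x - f x)" for n
    using u f by (rule set_integral_diff(1))
  have "(\<lambda>n. (LINT x:K|lebesgue. R x * u n x) - (LINT x:K|lebesgue. R x * f x)) \<longlonglongrightarrow> 0"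
  proof (rule Lim_null_comparison[OF always_eventually], rule allI)
    fix n
    have "(LINT x:K|lebesgue. R x * u n x) - (LINT x:K|lebesgue. R x * f x) = (LINT x:K|lebesgue. R x * (u n x - f x))"
      using set_integral_diff(2)[OF I[OF u] I[OF f]] by (simp add: right_diff_distrib)
    also have "norm \<dots> \<le> (LINT x:K|lebesgue. norm (R x * (u n x - f x)))"
      by (rule set_integral_norm_bound[OF I[OF d]])
    also have "\<dots> \<le> (LINT x:K|lebesgue. B * \<bar>u n x - f x\<bar>)"
    proof (rule set_integral_mono)
      show "set_integrable lebesgue K (\<lambda>x. norm (R x * (u n x - f x)))"
        using I[OF d] by (rule set_integrable_norm)
      show "set_integrable lebesgue K (\<lambda>x. B * \<bar>u n x - f x\<bar>)"
        using set_integrable_abs[OF d] by simp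
    qed (auto simp: abs_mult intro!: mult_right_mono B)
    finally show "norm ((LINT x:K|lebesgue. R x * u n x) - (LINT x:K|lebesgue. R x * f x)) \<le> B * (LINT x:K|lebesgue. \<bar>u n x - f x\<bar>)"
      by simp
  next
    show "(\<lambda>n. B * (LINT x:K|lebesgue. \<bar>u n x - f x\<bar>)) \<longlonglongrightarrow> 0"
      using tendsto_mult_right_zero[OF lim] by simp
  qed
  then show ?thesis by (simp add: LIM_zero_iff)
qed

lemma abs_indicator_powr: "\<bar>indicator A x * y\<bar> powr p = indicator A x * \<bar>y\<bar> powr p" for y :: real
  by (auto simp: indicator_def)

lemma finite_pim: "finite (pim m :: ('n::finite) mindex set)"
proof (rule finite_subset)
  show "pim m \<subseteq> (UNIV :: 'n set) \<rightarrow>\<^sub>E {..m}"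
  proof
    fix \<alpha> :: "'n mindex" assume "\<alpha> \<in> pim m"
    moreover have "\<alpha> i \<le> mlen \<alpha>" for i
      unfolding mlen_def by (rule member_le_sum) auto
    ultimately show "\<alpha> \<in> UNIV \<rightarrow>\<^sub>E {..m}"
      using order_trans unfolding pim_def by fastforce
  qed
qed (auto intro: finite_PiE)

lemma mlen_eq_0: "mlen \<alpha> = 0 \<longleftrightarrow> \<alpha> = (\<lambda>_. 0)"
  by (auto simp: mlen_def fun_eq_iff)

lemma zero_in_pim: "(\<lambda>_. 0) \<in> pim m"
  by (simp add: pim_def mlen_def)

lemma Dv_zero: "Dv \<Omega> v (\<lambda>_. 0) f = f"
  by (simp add: Dv_def mlen_def)

lemma is_wderiv_Dv:
  assumes "mlen \<alpha> \<noteq> 0" "is_wderiv \<Omega> v \<alpha> f g"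
  shows "is_wderiv \<Omega> v \<alpha> f (Dv \<Omega> v \<alpha> f)"
  using someI[of "is_wderiv \<Omega> v \<alpha> f" g] assms by (simp add: Dv_def)

lemma Wsp_is_wderiv:
  assumes "f \<in> Wsp m p \<Omega> w v" "\<alpha> \<in> pim m" "mlen \<alpha> \<noteq> 0"
  shows "is_wderiv \<Omega> v \<alpha> f (Dv \<Omega> v \<alpha> f)"
  using assms is_wderiv_Dv unfolding Wsp_def by blast

lemma Wsp_Dv_Lpw:
  assumes "f \<in> Wsp m p \<Omega> w v" "\<alpha> \<in> pim m"
  shows "Dv \<Omega> v \<alpha> f \<in> Lpw p \<Omega> (w \<alpha>)"
proof (cases "mlen \<alpha> = 0")
  case True
  with assms show ?thesis by (auto simp: mlen_eq_0 Dv_zero Wsp_def)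
qed (use assms in \<open>auto simp: Wsp_def\<close>)

lemma set_integral_powr_nonneg: "0 \<le> (LINT x:A|M. \<bar>f x :: real\<bar> powr p)"
  unfolding set_lebesgue_integral_def by (rule integral_nonneg_AE) auto

lemma Wnorm_term_less:
  assumes \<alpha>: "\<alpha> \<in> pim m" and less: "Wnorm m p \<Omega> w v f < e" and p: "0 < p"
  shows "(LINT x:\<Omega>|lebesgue. \<bar>w \<alpha> x * Dv \<Omega> v \<alpha> f x\<bar> powr p) < e powr p"
proof -
  let ?t = "\<lambda>\<alpha>. LINT x:\<Omega>|lebesgue. \<bar>w \<alpha> x * Dv \<Omega> v \<alpha> f x\<bar> powr p"
  have nonneg: "0 \<le> ?t \<beta>" for \<beta>
    by (rule set_integral_powr_nonneg)
  have "?t \<alpha> \<le> sum ?t (pim m)"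
    by (rule member_le_sum[OF \<alpha> nonneg finite_pim])
  also have "sum ?t (pim m) = Wnorm m p \<Omega> w v f powr p"
    using p sum_nonneg[of "pim m" ?t] nonneg by (simp add: Wnorm_def powr_powr)
  also have "\<dots> < e powr p"
    using less p by (intro powr_less_mono2) (auto simp: Wnorm_def)
  finally show ?thesis .
qed

section \<open>Local consequences of the weight condition\<close>

locale weighted_sobolev =
  fixes \<Omega> :: "(real^'n::finite) set" and p :: real and m :: nat
    and w :: "'n mindex \<Rightarrow> real^'n \<Rightarrow> real" and v :: "real^'n \<Rightarrow> real"
  assumes open_domain: "open \<Omega>" and p_ge_1: "1 \<le> p"
    and w_Ep: "\<alpha> \<in> pim m \<Longrightarrow> w \<alpha> \<in> Ep p \<Omega>"
    and Ck_v: "Ck_on m \<Omega> v" and v_nonzero: "AE x in lebesgue. x \<in> \<Omega> \<longrightarrow> v x \<noteq> 0"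
    and v_le_w: "\<alpha> \<in> pim m \<Longrightarrow> compact K \<Longrightarrow> K \<subseteq> \<Omega> \<Longrightarrow>
           \<exists>C>0. AE x in lebesgue. x \<in> K \<longrightarrow> \<bar>v x\<bar> ^ (mlen \<alpha> + 1) \<le> C * \<bar>w \<alpha> x\<bar>"
begin

lemma domain_measurable: "\<Omega> \<in> sets borel" "\<Omega> \<in> sets lebesgue"
  using open_domain by auto

lemma p_pos: "0 < p" using p_ge_1 by simp

lemma w_measurable: "\<alpha> \<in> pim m \<Longrightarrow> set_borel_measurable lebesgue \<Omega> (w \<alpha>)"
  using w_Ep by (simp add: Ep_def)

lemma w_nonzero:
  assumes "\<alpha> \<in> pim m"
  shows "AE x in lebesgue. x \<in> \<Omega> \<longrightarrow> w \<alpha> x \<noteq> 0"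
proof -
  have "AE x in lebesgue. x \<in> \<Omega> \<longrightarrow> \<bar>w \<alpha> x\<bar> powr p > 0"
    using w_Ep[OF assms] by (simp add: Ep_def weight_def)
  then show ?thesis by eventually_elim auto
qed

lemma v_power_measurable: "set_borel_measurable lebesgue \<Omega> (\<lambda>x. v x ^ k)"
  using domain_measurable Ck_on_imp_continuous_on[OF Ck_v]
  by (intro set_borel_measurable_lebesgue_continuous continuous_intros)

text \<open>\<open>f\<close> and \<open>w \<alpha>\<close> are measurable only on the domain.
  Extending the product by zero gives a function on the whole space, to which the unweighted Lp
  results apply.\<close>

lemma Lpw_restrict:
  assumes "\<alpha> \<in> pim m" "f \<in> Lpw p \<Omega> (w \<alpha>)"
  shows "(\<lambda>x. indicator \<Omega> x * (f x * w \<alpha> x)) \<in> borel_measurable lebesgue"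
    and "integrable lebesgue (\<lambda>x. \<bar>indicator \<Omega> x * (f x * w \<alpha> x)\<bar> powr p)"
  using set_borel_measurable_mult[OF _ w_measurable[OF assms(1)], of f] assms(2)
  unfolding Lpw_def set_borel_measurable_def set_integrable_def by (auto simp: abs_indicator_powr)

lemma Lpw_times_v_measurable:
  assumes "f \<in> Lpw p \<Omega> u" "compact K" "K \<subseteq> \<Omega>"
  shows "set_borel_measurable lebesgue K (\<lambda>x. f x * v x ^ k)"
  using assms
  by (intro set_borel_measurable_mono[OF set_borel_measurable_mult[OF _ v_power_measurable]])
    (auto simp: Lpw_def compact_imp_lmeasurable_sets)

text \<open>On \<open>K\<close> the weight condition bounds the integrand by
  \<open>C * \<bar>f * w \<alpha>\<bar>\<close>, an Lp function and hence integrable over a set of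
  finite measure.\<close>

lemma Lpw_imp_loc_integrable:
  assumes \<alpha>: "\<alpha> \<in> pim m" and f: "f \<in> Lpw p \<Omega> (w \<alpha>)" and K: "compact K" "K \<subseteq> \<Omega>"
  shows "set_integrable lebesgue K (\<lambda>x. f x * v x ^ (mlen \<alpha> + 1))"
proof -
  obtain C where C: "C > 0" "AE x in lebesgue. x \<in> K \<longrightarrow> \<bar>v x\<bar> ^ (mlen \<alpha> + 1) \<le> C * \<bar>w \<alpha> x\<bar>"
    using v_le_w[OF \<alpha> K] by blast
  have I: "set_integrable lebesgue K (\<lambda>x. indicator \<Omega> x * (f x * w \<alpha> x))"
    by (rule set_integrable_of_Lp[OF p_ge_1 compact_imp_lmeasurable_sets[OF K(1)] Lpw_restrict[OF \<alpha> f]])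
  show ?thesis
    unfolding set_integrable_def
  proof (rule Bochner_Integration.integrable_bound)
    show "integrable lebesgue (\<lambda>x. C * (indicator K x *\<^sub>R (indicator \<Omega> x * (f x * w \<alpha> x))))"
      using I unfolding set_integrable_def by simp
    show "(\<lambda>x. indicat_real K x *\<^sub>R (f x * v x ^ (mlen \<alpha> + 1))) \<in> borel_measurable lebesgue"
      using Lpw_times_v_measurable[OF f K] unfolding set_borel_measurable_def .
    show "AE x in lebesgue. norm (indicat_real K x *\<^sub>R (f x * v x ^ (mlen \<alpha> + 1)))
        \<le> norm (C * (indicator K x *\<^sub>R (indicator \<Omega> x * (f x * w \<alpha> x))))"
      using C(2)
    proof eventually_elim
      case (elim x)
      show ?case
      proof (cases "x \<in> K")
        case True
        with elim have "\<bar>f x\<bar> * \<bar>v x\<bar> ^ (mlen \<alpha> + 1) \<le> \<bar>f x\<bar> * (C * \<bar>w \<alpha> x\<bar>)"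
          by (intro mult_left_mono) auto
        then show ?thesis using True K(2) C(1) by (auto simp: abs_mult power_abs mult_ac)
      qed simp
    qed
  qed
qed

lemma Lpw_tendsto_imp_loc_tendsto:
  assumes \<alpha>: "\<alpha> \<in> pim m" and f: "\<And>n. f n \<in> Lpw p \<Omega> (w \<alpha>)" and K: "compact K" "K \<subseteq> \<Omega>"
    and lim: "(\<lambda>n. LINT x:\<Omega>|lebesgue. \<bar>f n x * w \<alpha> x\<bar> powr p) \<longlonglongrightarrow> 0"
  shows "(\<lambda>n. LINT x:K|lebesgue. \<bar>f n x * v x ^ (mlen \<alpha> + 1)\<bar>) \<longlonglongrightarrow> 0"
proof -
  obtain C where C: "C > 0" "AE x in lebesgue. x \<in> K \<longrightarrow> \<bar>v x\<bar> ^ (mlen \<alpha> + 1) \<le> C * \<bar>w \<alpha> x\<bar>"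
    using v_le_w[OF \<alpha> K] by blast
  note Ks = compact_imp_lmeasurable_sets[OF K(1)]
  define u where "u n x = indicator \<Omega> x * (f n x * w \<alpha> x)" for n x
  have u: "u n \<in> borel_measurable lebesgue" "integrable lebesgue (\<lambda>x. \<bar>u n x\<bar> powr p)" for n
    using Lpw_restrict[OF \<alpha> f, of n] unfolding u_def by blast+
  have "(\<lambda>n. \<integral>x. \<bar>u n x\<bar> powr p \<partial>lebesgue) \<longlonglongrightarrow> 0"
    using lim by (simp add: u_def abs_indicator_powr set_lebesgue_integral_def)
  then have "(\<lambda>n. LINT x:K|lebesgue. \<bar>u n x\<bar>) \<longlonglongrightarrow> 0"
    by (rule L1_tendsto_of_Lp_tendsto[OF p_ge_1 Ks u])
  then have lim': "(\<lambda>n. C * (LINT x:K|lebesgue. \<bar>u n x\<bar>)) \<longlonglongrightarrow> 0"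
    by (rule tendsto_mult_right_zero)
  show ?thesis
  proof (rule Lim_null_comparison[OF always_eventually lim'], rule allI)
    fix n
    have "(LINT x:K|lebesgue. \<bar>f n x * v x ^ (mlen \<alpha> + 1)\<bar>) \<le> (LINT x:K|lebesgue. C * \<bar>u n x\<bar>)"
    proof (rule set_integral_mono_AE)
      show "set_integrable lebesgue K (\<lambda>x. \<bar>f n x * v x ^ (mlen \<alpha> + 1)\<bar>)"
        by (intro set_integrable_abs Lpw_imp_loc_integrable \<alpha> f K)
      show "set_integrable lebesgue K (\<lambda>x. C * \<bar>u n x\<bar>)"
        using set_integrable_abs[OF set_integrable_of_Lp[OF p_ge_1 Ks u]] by simp
      show "AE x\<in>K in lebesgue. \<bar>f n x * v x ^ (mlen \<alpha> + 1)\<bar> \<le> C * \<bar>u n x\<bar>"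
        using C(2)
      proof eventually_elim
        case (elim x)
        show ?case
        proof
          assume x: "x \<in> K"
          with elim have "\<bar>f n x\<bar> * \<bar>v x\<bar> ^ (mlen \<alpha> + 1) \<le> \<bar>f n x\<bar> * (C * \<bar>w \<alpha> x\<bar>)"
            by (intro mult_left_mono) auto
          then show "\<bar>f n x * v x ^ (mlen \<alpha> + 1)\<bar> \<le> C * \<bar>u n x\<bar>"
            using x K(2) C(1) by (auto simp: u_def abs_mult power_abs mult_ac)
        qed
      qed
    qed
    moreover have "0 \<le> (LINT x:K|lebesgue. \<bar>f n x * v x ^ (mlen \<alpha> + 1)\<bar>)"
      unfolding set_lebesgue_integral_def by (rule integral_nonneg_AE) auto
    ultimately show "norm (LINT x:K|lebesgue. \<bar>f n x * v x ^ (mlen \<alpha> + 1)\<bar>) \<le> C * (LINT x:K|lebesgue. \<bar>u n x\<bar>)"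
      by simp
  qed
qed

text \<open>\<open>L1w_loc\<close> asks for integrability of the absolute value only; dropping it
  takes measurability of the signed product, which continuity of \<open>v\<close> supplies.\<close>

lemma L1w_loc_set_integrable:
  assumes "g \<in> L1w_loc \<Omega> (\<lambda>x. v x ^ k)" "compact K" "K \<subseteq> \<Omega>"
  shows "set_integrable lebesgue K (\<lambda>x. g x * v x ^ k)"
proof -
  have "set_borel_measurable lebesgue K (\<lambda>x. g x * v x ^ k)"
    using assms
    by (intro set_borel_measurable_mono[OF set_borel_measurable_mult[OF _ v_power_measurable]])
      (auto simp: L1w_loc_def compact_imp_lmeasurable_sets)
  then show ?thesis
    using assms set_integrable_abs_iff[of lebesgue K "\<lambda>x. g x * v x ^ k"] by (auto simp: L1w_loc_def)
qed

lemma L1w_locI: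
  assumes "set_borel_measurable lebesgue \<Omega> g"
    "\<And>K. compact K \<Longrightarrow> K \<subseteq> \<Omega> \<Longrightarrow> set_integrable lebesgue K (\<lambda>x. g x * u x)"
  shows "g \<in> L1w_loc \<Omega> u"
  using assms by (auto simp: L1w_loc_def intro: set_integrable_abs)

lemma set_integral_restrict_support:
  fixes f :: "real^'n \<Rightarrow> real"
  assumes "K \<subseteq> \<Omega>" "\<And>x. x \<in> \<Omega> \<Longrightarrow> x \<notin> K \<Longrightarrow> f x = 0" "\<And>x. x \<in> K \<Longrightarrow> f x = g x"
  shows "(LINT x:\<Omega>|lebesgue. f x) = (LINT x:K|lebesgue. g x)"
  unfolding set_lebesgue_integral_def
  by (rule Bochner_Integration.integral_cong) (use assms in \<open>auto simp: indicator_def\<close>)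

section \<open>The weak derivative identity on a fixed compact set\<close>

text \<open>\<open>K\<close> and \<open>R\<close> are fixed before \<open>f\<close> is quantified,
  so one pair serves a whole sequence and its limit. The product \<open>f * v\<close> is kept
  together because it is the locally integrable quantity.\<close>

lemma wderiv_lhs:
  assumes m: "mlen \<alpha> \<le> m" and \<phi>: "test_fun \<Omega> \<phi>"
  obtains K R where "compact K" "K \<subseteq> \<Omega>" "continuous_on K R"
    "\<And>f. (LINT x:\<Omega>|lebesgue. f x * Dcl \<alpha> (\<lambda>y. v y ^ (mlen \<alpha> + 1) * \<phi> y) x)
       = (LINT x:K|lebesgue. R x * (f x * v x))"
proof -
  define K where "K = closure {x. \<phi> x \<noteq> 0}"
  define l where "l = concat (map (\<lambda>i. replicate (\<alpha> i) i) (enum_idx :: 'n list))"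
  have l: "length l = mlen \<alpha>" unfolding l_def by (rule mlen_enum)
  have K: "compact K" "K \<subseteq> \<Omega>" using \<phi> by (auto simp: test_fun_def K_def)
  have "Ck_on (mlen \<alpha>) \<Omega> \<phi>"
    using \<phi> by (auto simp: test_fun_def intro: Ck_on_subset)
  \<comment> \<open>The numbers are sharp: \<open>mlen \<alpha>\<close> derivatives of a power with
    exponent \<open>mlen \<alpha> + 1\<close> leave exactly one \<open>v\<close>, and a cofactor of
    class 0, that is, merely continuous.\<close>
  from pdiffs_power_mult[OF open_domain Ck_on_mono[OF Ck_v m] this, of l "mlen \<alpha> + 1"]
  obtain R where R: "Ck_on 0 \<Omega> R"
    "\<And>x. x \<in> \<Omega> \<Longrightarrow> pdiffs l (\<lambda>y. v y ^ (mlen \<alpha> + 1) * \<phi> y) x = v x * R x"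
    unfolding l by auto
  have out: "pdiffs l (\<lambda>y. v y ^ (mlen \<alpha> + 1) * \<phi> y) x = 0" if "x \<notin> K" for x
  proof -
    \<comment> \<open>Openness turns vanishing of the test function off \<open>K\<close> into
      vanishing of all its derivatives there.\<close>
    have "open (- K)" using K(1) by (simp add: compact_imp_closed open_Compl)
    then have "pdiffs l (\<lambda>y. v y ^ (mlen \<alpha> + 1) * \<phi> y) x = pdiffs l (\<lambda>_. 0) x"
      using that closure_subset[of "{x. \<phi> x \<noteq> 0}"] by (intro pdiffs_cong[of "- K"]) (auto simp: K_def)
    then show ?thesis by (simp add: pdiffs_zero)
  qed
  show ?thesis
  proof (rule that[OF K])
    show "continuous_on K R"
      using Ck_on_imp_continuous_on[OF R(1)] K(2) continuous_on_subset by blast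
    fix f :: "real^'n \<Rightarrow> real"
    show "(LINT x:\<Omega>|lebesgue. f x * Dcl \<alpha> (\<lambda>y. v y ^ (mlen \<alpha> + 1) * \<phi> y) x)
       = (LINT x:K|lebesgue. R x * (f x * v x))"
      unfolding Dcl_def l_def[symmetric]
      by (rule set_integral_restrict_support[OF K(2)]) (use out R(2) K(2) in auto)
  qed
qed

lemma wderiv_rhs:
  assumes \<phi>: "test_fun \<Omega> \<phi>"
  obtains K where "compact K" "K \<subseteq> \<Omega>" "continuous_on K \<phi>"
    "\<And>g k. (LINT x:\<Omega>|lebesgue. v x ^ k * \<phi> x * g x) = (LINT x:K|lebesgue. \<phi> x * (g x * v x ^ k))"
proof -
  define K where "K = closure {x. \<phi> x \<noteq> 0}"
  have K: "compact K" "K \<subseteq> \<Omega>" using \<phi> by (auto simp: test_fun_def K_def)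
  show ?thesis
  proof (rule that[OF K])
    have "continuous_on UNIV \<phi>" using \<phi> Ck_on_imp_continuous_on[of 0] by (auto simp: test_fun_def)
    then show "continuous_on K \<phi>" by (rule continuous_on_subset) simp
    show "(LINT x:\<Omega>|lebesgue. v x ^ k * \<phi> x * g x) = (LINT x:K|lebesgue. \<phi> x * (g x * v x ^ k))" for g k
      using closure_subset[of "{x. \<phi> x \<noteq> 0}"]
      by (intro set_integral_restrict_support[OF K(2)]) (auto simp: K_def)
  qed
qed

lemma is_wderiv_eq:
  assumes "is_wderiv \<Omega> v \<alpha> f g" "test_fun \<Omega> \<phi>"
  shows "(LINT x:\<Omega>|lebesgue. f x * Dcl \<alpha> (\<lambda>y. v y ^ (mlen \<alpha> + 1) * \<phi> y) x)
    = (-1) ^ mlen \<alpha> * (LINT x:\<Omega>|lebesgue. v x ^ (mlen \<alpha> + 1) * \<phi> x * g x)"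
  using assms unfolding is_wderiv_def by blast

text \<open>Splitting the integral of a difference requires both parts to be integrable. This is why
  local integrability of \<open>f * v\<close> and \<open>f' * v\<close> is assumed, while
  \<open>is_wderiv\<close> itself provides it for \<open>g\<close> and \<open>g'\<close>.\<close>

lemma is_wderiv_diff:
  assumes \<alpha>: "mlen \<alpha> \<le> m"
    and f: "\<And>K. compact K \<Longrightarrow> K \<subseteq> \<Omega> \<Longrightarrow> set_integrable lebesgue K (\<lambda>x. f x * v x)"
    and f': "\<And>K. compact K \<Longrightarrow> K \<subseteq> \<Omega> \<Longrightarrow> set_integrable lebesgue K (\<lambda>x. f' x * v x)"
    and g: "is_wderiv \<Omega> v \<alpha> f g" and g': "is_wderiv \<Omega> v \<alpha> f' g'"
  shows "is_wderiv \<Omega> v \<alpha> (\<lambda>x. f x - f' x) (\<lambda>x. g x - g' x)"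
proof -
  let ?k = "mlen \<alpha> + 1"
  have L: "g \<in> L1w_loc \<Omega> (\<lambda>x. v x ^ ?k)" "g' \<in> L1w_loc \<Omega> (\<lambda>x. v x ^ ?k)"
    using g g' by (auto simp: is_wderiv_def)
  note I = L[THEN L1w_loc_set_integrable]
  show ?thesis
    unfolding is_wderiv_def
  proof (intro conjI allI impI)
    show "(\<lambda>x. g x - g' x) \<in> L1w_loc \<Omega> (\<lambda>x. v x ^ ?k)"
    proof (rule L1w_locI)
      show "set_borel_measurable lebesgue \<Omega> (\<lambda>x. g x - g' x)"
        using L by (intro set_borel_measurable_minus) (auto simp: L1w_loc_def)
      show "set_integrable lebesgue K (\<lambda>x. (g x - g' x) * v x ^ ?k)" if "compact K" "K \<subseteq> \<Omega>" for K
        using set_integral_diff(1)[OF I(1)[OF that] I(2)[OF that]] by (simp add: left_diff_distrib)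
    qed
    fix \<phi> assume \<phi>: "test_fun \<Omega> \<phi>"
    obtain K R where K: "compact K" "K \<subseteq> \<Omega>" "continuous_on K R"
      and lhs: "\<And>f. (LINT x:\<Omega>|lebesgue. f x * Dcl \<alpha> (\<lambda>y. v y ^ ?k * \<phi> y) x)
       = (LINT x:K|lebesgue. R x * (f x * v x))"
      by (rule wderiv_lhs[OF \<alpha> \<phi>]) (rule that)
    obtain K' where K': "compact K'" "K' \<subseteq> \<Omega>" "continuous_on K' \<phi>"
      and rhs: "\<And>g k. (LINT x:\<Omega>|lebesgue. v x ^ k * \<phi> x * g x) = (LINT x:K'|lebesgue. \<phi> x * (g x * v x ^ k))"
      by (rule wderiv_rhs[OF \<phi>]) (rule that)
    have eq: "(LINT x:K|lebesgue. R x * (f x * v x)) = (-1) ^ mlen \<alpha> * (LINT x:K'|lebesgue. \<phi> x * (g x * v x ^ ?k))"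
      "(LINT x:K|lebesgue. R x * (f' x * v x)) = (-1) ^ mlen \<alpha> * (LINT x:K'|lebesgue. \<phi> x * (g' x * v x ^ ?k))"
      by (rule is_wderiv_eq[OF g \<phi>, unfolded lhs rhs], rule is_wderiv_eq[OF g' \<phi>, unfolded lhs rhs])
    have "(LINT x:K|lebesgue. R x * ((f x - f' x) * v x)) =
        (LINT x:K|lebesgue. R x * (f x * v x)) - (LINT x:K|lebesgue. R x * (f' x * v x))"
      using set_integral_diff(2)[OF set_integrable_continuous_mult[OF K(1,3) f[OF K(1,2)]]
          set_integrable_continuous_mult[OF K(1,3) f'[OF K(1,2)]]]
      by (simp add: algebra_simps)
    moreover have "(LINT x:K'|lebesgue. \<phi> x * ((g x - g' x) * v x ^ ?k)) =
        (LINT x:K'|lebesgue. \<phi> x * (g x * v x ^ ?k)) - (LINT x:K'|lebesgue. \<phi> x * (g' x * v x ^ ?k))"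
      using set_integral_diff(2)[OF set_integrable_continuous_mult[OF K'(1,3) I(1)[OF K'(1,2)]]
          set_integrable_continuous_mult[OF K'(1,3) I(2)[OF K'(1,2)]]]
      by (simp add: algebra_simps)
    ultimately show "(LINT x:\<Omega>|lebesgue. (f x - f' x) * Dcl \<alpha> (\<lambda>y. v y ^ ?k * \<phi> y) x)
        = (-1) ^ mlen \<alpha> * (LINT x:\<Omega>|lebesgue. v x ^ ?k * \<phi> x * (g x - g' x))"
      unfolding lhs rhs eq by (simp add: right_diff_distrib)
  qed
qed

text \<open>Both candidates share the left-hand side, so du Bois-Reymond applies to
  \<open>(g - g') * v ^ (mlen \<alpha> + 1)\<close>; the power of \<open>v\<close> cancels because
  \<open>v\<close> is nonzero almost everywhere.\<close>

lemma is_wderiv_unique: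
  assumes g: "is_wderiv \<Omega> v \<alpha> f g" and g': "is_wderiv \<Omega> v \<alpha> f g'"
  shows "AE x in lebesgue. x \<in> \<Omega> \<longrightarrow> g x = g' x"
proof -
  let ?k = "mlen \<alpha> + 1"
  have L: "g \<in> L1w_loc \<Omega> (\<lambda>x. v x ^ ?k)" "g' \<in> L1w_loc \<Omega> (\<lambda>x. v x ^ ?k)"
    using g g' by (auto simp: is_wderiv_def)
  note I = L[THEN L1w_loc_set_integrable]
  have "AE x in lebesgue. x \<in> \<Omega> \<longrightarrow> g x * v x ^ ?k - g' x * v x ^ ?k = 0"
  proof (rule du_Bois_Reymond[OF open_domain])
    show "set_integrable lebesgue K (\<lambda>x. g x * v x ^ ?k - g' x * v x ^ ?k)" if "compact K" "K \<subseteq> \<Omega>" for K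
      by (rule set_integral_diff(1)[OF I(1)[OF that] I(2)[OF that]])
    fix \<phi> assume \<phi>: "test_fun \<Omega> \<phi>"
    obtain K where K: "compact K" "K \<subseteq> \<Omega>" "continuous_on K \<phi>"
      and rhs: "\<And>g k. (LINT x:\<Omega>|lebesgue. v x ^ k * \<phi> x * g x) = (LINT x:K|lebesgue. \<phi> x * (g x * v x ^ k))"
      by (rule wderiv_rhs[OF \<phi>]) (rule that)
    have "(LINT x:\<Omega>|lebesgue. f x * Dcl \<alpha> (\<lambda>y. v y ^ ?k * \<phi> y) x) =
        (-1) ^ mlen \<alpha> * (LINT x:K|lebesgue. \<phi> x * (g x * v x ^ ?k))"
      and "(LINT x:\<Omega>|lebesgue. f x * Dcl \<alpha> (\<lambda>y. v y ^ ?k * \<phi> y) x) =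
        (-1) ^ mlen \<alpha> * (LINT x:K|lebesgue. \<phi> x * (g' x * v x ^ ?k))"
      by (rule is_wderiv_eq[OF g \<phi>, unfolded rhs], rule is_wderiv_eq[OF g' \<phi>, unfolded rhs])
    then have eq: "(LINT x:K|lebesgue. \<phi> x * (g x * v x ^ ?k)) = (LINT x:K|lebesgue. \<phi> x * (g' x * v x ^ ?k))"
      by simp
    have "(LINT x:\<Omega>|lebesgue. \<phi> x * (g x * v x ^ ?k - g' x * v x ^ ?k)) =
        (LINT x:\<Omega>|lebesgue. v x ^ ?k * \<phi> x * (g x - g' x))"
      by (simp add: algebra_simps)
    also have "\<dots> = (LINT x:K|lebesgue. \<phi> x * (g x * v x ^ ?k) - \<phi> x * (g' x * v x ^ ?k))"
      by (subst rhs) (simp add: algebra_simps)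
    also have "\<dots> = 0"
      using set_integral_diff(2)[OF set_integrable_continuous_mult[OF K(1,3) I(1)[OF K(1,2)]]
          set_integrable_continuous_mult[OF K(1,3) I(2)[OF K(1,2)]]] eq by simp
    finally show "(LINT x:\<Omega>|lebesgue. \<phi> x * (g x * v x ^ ?k - g' x * v x ^ ?k)) = 0" .
  qed
  with v_nonzero show ?thesis
    by eventually_elim auto
qed

text \<open>Closedness of the weak derivative: for a fixed test function, each side is an integral
  over a fixed compact set against a fixed continuous factor, hence continuous in local L1.\<close>

lemma is_wderiv_limit:
  assumes \<alpha>: "mlen \<alpha> \<le> m"
    and F: "\<And>K n. compact K \<Longrightarrow> K \<subseteq> \<Omega> \<Longrightarrow> set_integrable lebesgue K (\<lambda>x. F n x * v x)"
    and f: "\<And>K. compact K \<Longrightarrow> K \<subseteq> \<Omega> \<Longrightarrow> set_integrable lebesgue K (\<lambda>x. f x * v x)"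
    and Ff: "\<And>K. compact K \<Longrightarrow> K \<subseteq> \<Omega> \<Longrightarrow> (\<lambda>n. LINT x:K|lebesgue. \<bar>(F n x - f x) * v x\<bar>) \<longlonglongrightarrow> 0"
    and G: "\<And>n. is_wderiv \<Omega> v \<alpha> (F n) (G n)"
    and g: "g \<in> L1w_loc \<Omega> (\<lambda>x. v x ^ (mlen \<alpha> + 1))"
    and Gg: "\<And>K. compact K \<Longrightarrow> K \<subseteq> \<Omega> \<Longrightarrow>
      (\<lambda>n. LINT x:K|lebesgue. \<bar>(G n x - g x) * v x ^ (mlen \<alpha> + 1)\<bar>) \<longlonglongrightarrow> 0"
  shows "is_wderiv \<Omega> v \<alpha> f g"
  unfolding is_wderiv_def
proof (intro conjI allI impI)
  let ?k = "mlen \<alpha> + 1"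
  fix \<phi> assume \<phi>: "test_fun \<Omega> \<phi>"
  obtain K R where K: "compact K" "K \<subseteq> \<Omega>" "continuous_on K R"
    and lhs: "\<And>f. (LINT x:\<Omega>|lebesgue. f x * Dcl \<alpha> (\<lambda>y. v y ^ ?k * \<phi> y) x)
     = (LINT x:K|lebesgue. R x * (f x * v x))"
    by (rule wderiv_lhs[OF \<alpha> \<phi>]) (rule that)
  obtain K' where K': "compact K'" "K' \<subseteq> \<Omega>" "continuous_on K' \<phi>"
    and rhs: "\<And>g k. (LINT x:\<Omega>|lebesgue. v x ^ k * \<phi> x * g x) = (LINT x:K'|lebesgue. \<phi> x * (g x * v x ^ k))"
    by (rule wderiv_rhs[OF \<phi>]) (rule that)
  have GL: "G n \<in> L1w_loc \<Omega> (\<lambda>x. v x ^ ?k)" for n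
    using G[of n] by (simp add: is_wderiv_def)
  have "(\<lambda>n. LINT x:K|lebesgue. R x * (F n x * v x)) \<longlonglongrightarrow> (LINT x:K|lebesgue. R x * (f x * v x))"
    by (rule tendsto_integral_continuous_mult[OF K(1,3) F[OF K(1,2)] f[OF K(1,2)]])
      (use Ff[OF K(1,2)] in \<open>simp only: left_diff_distrib\<close>)
  moreover have "(\<lambda>n. (-1) ^ mlen \<alpha> * (LINT x:K'|lebesgue. \<phi> x * (G n x * v x ^ ?k)))
      \<longlonglongrightarrow> (-1) ^ mlen \<alpha> * (LINT x:K'|lebesgue. \<phi> x * (g x * v x ^ ?k))"
    by (rule tendsto_mult_left, rule tendsto_integral_continuous_mult[OF K'(1,3)
        L1w_loc_set_integrable[OF GL K'(1,2)] L1w_loc_set_integrable[OF g K'(1,2)]])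
      (use Gg[OF K'(1,2)] in \<open>simp only: left_diff_distrib\<close>)
  moreover have "(LINT x:K|lebesgue. R x * (F n x * v x)) = (-1) ^ mlen \<alpha> * (LINT x:K'|lebesgue. \<phi> x * (G n x * v x ^ ?k))" for n
    by (rule is_wderiv_eq[OF G \<phi>, unfolded lhs rhs])
  ultimately show "(LINT x:\<Omega>|lebesgue. f x * Dcl \<alpha> (\<lambda>y. v y ^ ?k * \<phi> y) x)
      = (-1) ^ mlen \<alpha> * (LINT x:\<Omega>|lebesgue. v x ^ ?k * \<phi> x * g x)"
    unfolding lhs rhs by (simp only: LIMSEQ_unique)
qed fact

section \<open>Weighted Lp spaces and differences of chosen derivatives\<close>

lemma Lpw_diff:
  assumes \<alpha>: "\<alpha> \<in> pim m" and fg: "f \<in> Lpw p \<Omega> (w \<alpha>)" "g \<in> Lpw p \<Omega> (w \<alpha>)"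
  shows "(\<lambda>x. f x - g x) \<in> Lpw p \<Omega> (w \<alpha>)"
proof -
  have "integrable lebesgue (\<lambda>x. \<bar>indicator \<Omega> x * (f x * w \<alpha> x) - indicator \<Omega> x * (g x * w \<alpha> x)\<bar> powr p)"
    by (intro integrable_powr_diff p_pos Lpw_restrict[OF \<alpha>] fg)
  also have "(\<lambda>x. \<bar>indicator \<Omega> x * (f x * w \<alpha> x) - indicator \<Omega> x * (g x * w \<alpha> x)\<bar> powr p) =
      (\<lambda>x. indicator \<Omega> x * \<bar>(f x - g x) * w \<alpha> x\<bar> powr p)"
    by (simp only: right_diff_distrib[symmetric] left_diff_distrib[symmetric] abs_indicator_powr)
  finally show ?thesis
    using fg by (auto simp: Lpw_def set_integrable_def intro!: set_borel_measurable_minus)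
qed

lemma Lpw_times_v_integrable:
  assumes "f \<in> Lpw p \<Omega> (w (\<lambda>_. 0))" "compact K" "K \<subseteq> \<Omega>"
  shows "set_integrable lebesgue K (\<lambda>x. f x * v x)"
  using Lpw_imp_loc_integrable[OF zero_in_pim assms] by (simp add: mlen_def)

lemma powr_times_w_measurable:
  assumes "\<alpha> \<in> pim m" "set_borel_measurable lebesgue \<Omega> f"
  shows "(\<lambda>x. indicator \<Omega> x *\<^sub>R \<bar>f x * w \<alpha> x\<bar> powr p) \<in> borel_measurable lebesgue"
proof -
  have "(\<lambda>x. \<bar>indicator \<Omega> x * (f x * w \<alpha> x)\<bar> powr p) \<in> borel_measurable lebesgue"
    using set_borel_measurable_mult[OF assms(2) w_measurable[OF assms(1)]]
    unfolding set_borel_measurable_def by simp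
  then show ?thesis by (simp add: abs_indicator_powr)
qed

lemma set_integral_powr_cong:
  assumes \<alpha>: "\<alpha> \<in> pim m" and ae: "AE x in lebesgue. x \<in> \<Omega> \<longrightarrow> f x = g x"
    and f: "set_borel_measurable lebesgue \<Omega> f" and g: "set_borel_measurable lebesgue \<Omega> g"
  shows "(LINT x:\<Omega>|lebesgue. \<bar>f x * w \<alpha> x\<bar> powr p) = (LINT x:\<Omega>|lebesgue. \<bar>g x * w \<alpha> x\<bar> powr p)"
  unfolding set_lebesgue_integral_def
  by (rule integral_cong_AE[OF powr_times_w_measurable[OF \<alpha> f] powr_times_w_measurable[OF \<alpha> g]])
    (use ae in \<open>eventually_elim, auto simp: indicator_def\<close>)

lemma Lpw_AE_cong:
  assumes \<alpha>: "\<alpha> \<in> pim m" and f: "f \<in> Lpw p \<Omega> (w \<alpha>)" and g: "set_borel_measurable lebesgue \<Omega> g"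
    and ae: "AE x in lebesgue. x \<in> \<Omega> \<longrightarrow> f x = g x"
  shows "g \<in> Lpw p \<Omega> (w \<alpha>)"
proof -
  have fm: "set_borel_measurable lebesgue \<Omega> f"
    and fi: "integrable lebesgue (\<lambda>x. indicator \<Omega> x *\<^sub>R \<bar>f x * w \<alpha> x\<bar> powr p)"
    using f by (auto simp: Lpw_def set_integrable_def)
  have "AE x in lebesgue. indicator \<Omega> x *\<^sub>R \<bar>f x * w \<alpha> x\<bar> powr p = indicator \<Omega> x *\<^sub>R \<bar>g x * w \<alpha> x\<bar> powr p"
    using ae by eventually_elim (auto simp: indicator_def)
  from integrable_cong_AE_imp[OF fi powr_times_w_measurable[OF \<alpha> g] this]
  show ?thesis using g by (auto simp: Lpw_def set_integrable_def)
qed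

text \<open>The difference of the two choices is a weak derivative of \<open>f - g\<close>, and
  uniqueness identifies it with the choice made for \<open>f - g\<close>. Measurability of the
  latter is recorded too, since comparing the integrals of almost everywhere equal functions calls
  for it.\<close>

lemma Dv_diff:
  assumes f: "f \<in> Wsp m p \<Omega> w v" and g: "g \<in> Wsp m p \<Omega> w v" and \<alpha>: "\<alpha> \<in> pim m"
  shows "AE x in lebesgue. x \<in> \<Omega> \<longrightarrow> Dv \<Omega> v \<alpha> (\<lambda>x. f x - g x) x = Dv \<Omega> v \<alpha> f x - Dv \<Omega> v \<alpha> g x"
    and "set_borel_measurable lebesgue \<Omega> (Dv \<Omega> v \<alpha> (\<lambda>x. f x - g x))"
proof -
  have fg: "f \<in> Lpw p \<Omega> (w (\<lambda>_. 0))" "g \<in> Lpw p \<Omega> (w (\<lambda>_. 0))"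
    using f g by (auto simp: Wsp_def)
  have "(AE x in lebesgue. x \<in> \<Omega> \<longrightarrow> Dv \<Omega> v \<alpha> (\<lambda>x. f x - g x) x = Dv \<Omega> v \<alpha> f x - Dv \<Omega> v \<alpha> g x) \<and>
    set_borel_measurable lebesgue \<Omega> (Dv \<Omega> v \<alpha> (\<lambda>x. f x - g x))"
  proof (cases "mlen \<alpha> = 0")
    case True
    then show ?thesis
      using fg by (auto simp: mlen_eq_0 Dv_zero Lpw_def intro: set_borel_measurable_minus)
  next
    case False
    have d: "is_wderiv \<Omega> v \<alpha> (\<lambda>x. f x - g x) (\<lambda>x. Dv \<Omega> v \<alpha> f x - Dv \<Omega> v \<alpha> g x)"
      by (rule is_wderiv_diff[OF _ Lpw_times_v_integrable[OF fg(1)] Lpw_times_v_integrable[OF fg(2)]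
            Wsp_is_wderiv[OF f \<alpha> False] Wsp_is_wderiv[OF g \<alpha> False]])
        (use \<alpha> in \<open>simp add: pim_def\<close>)
    note D = is_wderiv_Dv[OF False d]
    have "set_borel_measurable lebesgue \<Omega> (Dv \<Omega> v \<alpha> (\<lambda>x. f x - g x))"
      using D by (simp add: is_wderiv_def L1w_loc_def)
    with is_wderiv_unique[OF D d] show ?thesis by blast
  qed
  then show "AE x in lebesgue. x \<in> \<Omega> \<longrightarrow> Dv \<Omega> v \<alpha> (\<lambda>x. f x - g x) x = Dv \<Omega> v \<alpha> f x - Dv \<Omega> v \<alpha> g x"
    and "set_borel_measurable lebesgue \<Omega> (Dv \<Omega> v \<alpha> (\<lambda>x. f x - g x))" by auto
qed

text \<open>Translates between the norm of a difference and weighted Lp distances of derivatives; it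
  serves for the Cauchy hypothesis and again for the final convergence.\<close>

lemma Wnorm_diff_term:
  assumes f: "f \<in> Wsp m p \<Omega> w v" and g: "g \<in> Wsp m p \<Omega> w v" and \<alpha>: "\<alpha> \<in> pim m"
  shows "(LINT x:\<Omega>|lebesgue. \<bar>w \<alpha> x * Dv \<Omega> v \<alpha> (\<lambda>x. f x - g x) x\<bar> powr p)
    = (LINT x:\<Omega>|lebesgue. \<bar>(Dv \<Omega> v \<alpha> f x - Dv \<Omega> v \<alpha> g x) * w \<alpha> x\<bar> powr p)"
proof -
  have "set_borel_measurable lebesgue \<Omega> (\<lambda>x. Dv \<Omega> v \<alpha> f x - Dv \<Omega> v \<alpha> g x)"
    using Lpw_diff[OF \<alpha> Wsp_Dv_Lpw[OF f \<alpha>] Wsp_Dv_Lpw[OF g \<alpha>]] by (simp add: Lpw_def)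
  from set_integral_powr_cong[OF \<alpha> Dv_diff[OF f g \<alpha>] this]
  show ?thesis by (simp add: mult.commute)
qed

text \<open>Multiplication by \<open>w \<alpha>\<close>, followed by extension by zero, embeds the
  weighted space isometrically into Lp. Division by the almost everywhere nonzero weight brings the
  limit back.\<close>

lemma Lpw_complete:
  assumes \<alpha>: "\<alpha> \<in> pim m" and f: "\<And>n. f n \<in> Lpw p \<Omega> (w \<alpha>)"
    and Cauchy: "\<And>e. e > 0 \<Longrightarrow> \<exists>N. \<forall>n\<ge>N. \<forall>k\<ge>N. (LINT x:\<Omega>|lebesgue. \<bar>(f n x - f k x) * w \<alpha> x\<bar> powr p) < e"
  shows "\<exists>g \<in> Lpw p \<Omega> (w \<alpha>). (\<lambda>n. LINT x:\<Omega>|lebesgue. \<bar>(f n x - g x) * w \<alpha> x\<bar> powr p) \<longlonglongrightarrow> 0"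
proof -
  define u where "u n x = indicator \<Omega> x * (f n x * w \<alpha> x)" for n x
  have u: "u n \<in> borel_measurable lebesgue" "integrable lebesgue (\<lambda>x. \<bar>u n x\<bar> powr p)" for n
    using Lpw_restrict[OF \<alpha> f, of n] unfolding u_def by blast+
  have u_diff: "(\<integral>x. \<bar>u n x - u k x\<bar> powr p \<partial>lebesgue) = (LINT x:\<Omega>|lebesgue. \<bar>(f n x - f k x) * w \<alpha> x\<bar> powr p)" for n k
    unfolding set_lebesgue_integral_def u_def
    by (simp only: right_diff_distrib[symmetric] left_diff_distrib[symmetric] abs_indicator_powr real_scaleR_def)
  obtain h where h: "h \<in> borel_measurable lebesgue" "integrable lebesgue (\<lambda>x. \<bar>h x\<bar> powr p)"
    and lim: "(\<lambda>n. \<integral>x. \<bar>u n x - h x\<bar> powr p \<partial>lebesgue) \<longlonglongrightarrow> 0"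
    using Lp_complete[OF p_pos u Cauchy[folded u_diff]] by blast
  \<comment> \<open>At zeros of the weight, division by zero gives \<open>g x = 0\<close>, so
    \<open>\<bar>g x * w \<alpha> x\<bar> \<le> \<bar>h x\<bar>\<close> holds at every point, with
    equality almost everywhere in the domain.\<close>
  define g where "g x = h x / w \<alpha> x" for x
  \<comment> \<open>The weight is measurable only after restriction, hence the indicator in the
    denominator; outside the domain the outer indicator annihilates the quotient.\<close>
  have "(\<lambda>x. indicator \<Omega> x * (h x / (indicator \<Omega> x *\<^sub>R w \<alpha> x))) \<in> borel_measurable lebesgue"
    using w_measurable[OF \<alpha>] h(1) domain_measurable unfolding set_borel_measurable_def by measurable
  also have "(\<lambda>x. indicator \<Omega> x * (h x / (indicator \<Omega> x *\<^sub>R w \<alpha> x))) = (\<lambda>x. indicator \<Omega> x *\<^sub>R g x)"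
    by (auto simp: fun_eq_iff g_def indicator_def)
  finally have g_meas: "set_borel_measurable lebesgue \<Omega> g"
    unfolding set_borel_measurable_def .
  have g: "g \<in> Lpw p \<Omega> (w \<alpha>)"
    unfolding Lpw_def set_integrable_def
  proof (intro CollectI conjI g_meas, rule Bochner_Integration.integrable_bound[OF h(2)])
    show "(\<lambda>x. indicat_real \<Omega> x *\<^sub>R \<bar>g x * w \<alpha> x\<bar> powr p) \<in> borel_measurable lebesgue"
      by (rule powr_times_w_measurable[OF \<alpha> g_meas])
    show "AE x in lebesgue. norm (indicat_real \<Omega> x *\<^sub>R \<bar>g x * w \<alpha> x\<bar> powr p) \<le> norm (\<bar>h x\<bar> powr p)"
      by (rule AE_I2) (auto simp: g_def indicator_def)
  qed
  show ?thesis
  \<comment> \<open>The limit \<open>h\<close> was found on the whole space and nothing is recorded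
    about it outside the domain, so the restricted integrals are only bounded by the unrestricted
    ones.\<close>
  proof (rule bexI[OF _ g], rule tendsto_sandwich[OF _ _ tendsto_const lim])
    show "eventually (\<lambda>n. 0 \<le> (LINT x:\<Omega>|lebesgue. \<bar>(f n x - g x) * w \<alpha> x\<bar> powr p)) sequentially"
      by (intro always_eventually allI set_integral_powr_nonneg)
    show "eventually (\<lambda>n. (LINT x:\<Omega>|lebesgue. \<bar>(f n x - g x) * w \<alpha> x\<bar> powr p) \<le> (\<integral>x. \<bar>u n x - h x\<bar> powr p \<partial>lebesgue)) sequentially"
      unfolding set_lebesgue_integral_def
    proof (rule always_eventually, rule allI, rule integral_mono_AE)
      fix n
      show "integrable lebesgue (\<lambda>x. indicat_real \<Omega> x *\<^sub>R \<bar>(f n x - g x) * w \<alpha> x\<bar> powr p)"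
        using Lpw_diff[OF \<alpha> f g, of n] by (simp add: Lpw_def set_integrable_def)
      show "integrable lebesgue (\<lambda>x. \<bar>u n x - h x\<bar> powr p)"
        by (intro integrable_powr_diff p_pos u h)
      show "AE x in lebesgue. indicat_real \<Omega> x *\<^sub>R \<bar>(f n x - g x) * w \<alpha> x\<bar> powr p \<le> \<bar>u n x - h x\<bar> powr p"
        using w_nonzero[OF \<alpha>]
        by eventually_elim (auto simp: u_def g_def indicator_def left_diff_distrib)
    qed
  qed
qed

theorem Wsp_complete:
  assumes F: "\<And>n. F n \<in> Wsp m p \<Omega> w v"
    and Cauchy: "\<And>e. e > 0 \<Longrightarrow> \<exists>N. \<forall>n\<ge>N. \<forall>k\<ge>N. Wnorm m p \<Omega> w v (\<lambda>x. F n x - F k x) < e"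
  shows "\<exists>f\<in>Wsp m p \<Omega> w v. (\<lambda>n. Wnorm m p \<Omega> w v (\<lambda>x. F n x - f x)) \<longlonglongrightarrow> 0"
proof -
  have "\<exists>g \<in> Lpw p \<Omega> (w \<alpha>). (\<lambda>n. LINT x:\<Omega>|lebesgue. \<bar>(Dv \<Omega> v \<alpha> (F n) x - g x) * w \<alpha> x\<bar> powr p) \<longlonglongrightarrow> 0"
    if \<alpha>: "\<alpha> \<in> pim m" for \<alpha>
  proof (rule Lpw_complete[OF \<alpha>])
    show "Dv \<Omega> v \<alpha> (F n) \<in> Lpw p \<Omega> (w \<alpha>)" for n
      by (rule Wsp_Dv_Lpw[OF F \<alpha>])
    fix e :: real assume e: "e > 0"
    \<comment> \<open>The tolerance is \<open>e powr (1 / p)\<close> because the norm takes a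
      \<open>p\<close>-th root while the Lp estimate concerns the integral itself.\<close>
    then obtain N where N: "\<And>n k. n \<ge> N \<Longrightarrow> k \<ge> N \<Longrightarrow> Wnorm m p \<Omega> w v (\<lambda>x. F n x - F k x) < e powr (1 / p)"
      using Cauchy[of "e powr (1 / p)"] by (metis powr_gt_zero less_irrefl)
    have "(LINT x:\<Omega>|lebesgue. \<bar>(Dv \<Omega> v \<alpha> (F n) x - Dv \<Omega> v \<alpha> (F k) x) * w \<alpha> x\<bar> powr p) < e"
      if "n \<ge> N" "k \<ge> N" for n k
      using Wnorm_term_less[OF \<alpha> N[OF that] p_pos] e p_pos
      unfolding Wnorm_diff_term[OF F F \<alpha>] by (simp add: powr_powr)
    then show "\<exists>N. \<forall>n\<ge>N. \<forall>k\<ge>N. (LINT x:\<Omega>|lebesgue. \<bar>(Dv \<Omega> v \<alpha> (F n) x - Dv \<Omega> v \<alpha> (F k) x) * w \<alpha> x\<bar> powr p) < e"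
      by blast
  qed
  then have "\<forall>\<alpha>. \<exists>g. \<alpha> \<in> pim m \<longrightarrow> g \<in> Lpw p \<Omega> (w \<alpha>) \<and>
      (\<lambda>n. LINT x:\<Omega>|lebesgue. \<bar>(Dv \<Omega> v \<alpha> (F n) x - g x) * w \<alpha> x\<bar> powr p) \<longlonglongrightarrow> 0"
    by blast
  from choice[OF this] obtain g where g: "\<And>\<alpha>. \<alpha> \<in> pim m \<Longrightarrow> g \<alpha> \<in> Lpw p \<Omega> (w \<alpha>)"
    and lim: "\<And>\<alpha>. \<alpha> \<in> pim m \<Longrightarrow>
      (\<lambda>n. LINT x:\<Omega>|lebesgue. \<bar>(Dv \<Omega> v \<alpha> (F n) x - g \<alpha> x) * w \<alpha> x\<bar> powr p) \<longlonglongrightarrow> 0"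
    by blast
  define f where "f = g (\<lambda>_. 0)"
  note z = zero_in_pim[of m]
  have F0: "F n \<in> Lpw p \<Omega> (w (\<lambda>_. 0))" for n
    using F by (simp add: Wsp_def)
  have f0: "f \<in> Lpw p \<Omega> (w (\<lambda>_. 0))"
    unfolding f_def by (rule g[OF z])
  have wd: "is_wderiv \<Omega> v \<alpha> f (g \<alpha>)" if \<alpha>: "\<alpha> \<in> pim m" and nz: "mlen \<alpha> \<noteq> 0" for \<alpha>
  proof (rule is_wderiv_limit)
    show "mlen \<alpha> \<le> m" using \<alpha> by (simp add: pim_def)
    show "is_wderiv \<Omega> v \<alpha> (F n) (Dv \<Omega> v \<alpha> (F n))" for n
      by (rule Wsp_is_wderiv[OF F \<alpha> nz])
    show "g \<alpha> \<in> L1w_loc \<Omega> (\<lambda>x. v x ^ (mlen \<alpha> + 1))"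
      using g[OF \<alpha>] by (intro L1w_locI Lpw_imp_loc_integrable[OF \<alpha>]) (auto simp: Lpw_def)
    fix K assume K: "compact K" "K \<subseteq> \<Omega>"
    show "set_integrable lebesgue K (\<lambda>x. F n x * v x)" for n
      by (rule Lpw_times_v_integrable[OF F0 K])
    show "set_integrable lebesgue K (\<lambda>x. f x * v x)"
      by (rule Lpw_times_v_integrable[OF f0 K])
    show "(\<lambda>n. LINT x:K|lebesgue. \<bar>(F n x - f x) * v x\<bar>) \<longlonglongrightarrow> 0"
      using Lpw_tendsto_imp_loc_tendsto[OF z Lpw_diff[OF z F0 f0] K] lim[OF z]
      by (simp add: Dv_zero f_def mlen_def)
    show "(\<lambda>n. LINT x:K|lebesgue. \<bar>(Dv \<Omega> v \<alpha> (F n) x - g \<alpha> x) * v x ^ (mlen \<alpha> + 1)\<bar>) \<longlonglongrightarrow> 0"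
      by (rule Lpw_tendsto_imp_loc_tendsto[OF \<alpha> Lpw_diff[OF \<alpha> Wsp_Dv_Lpw[OF F \<alpha>] g[OF \<alpha>]] K lim[OF \<alpha>]])
  qed
  \<comment> \<open>\<open>g \<alpha>\<close> is a weak derivative of \<open>f\<close>, but
    membership in \<open>Wsp\<close> and the norm speak of \<open>Dv\<close>, so its measurability
    and almost everywhere equality with \<open>g \<alpha>\<close> are secured first.\<close>
  have Dv_f: "AE x in lebesgue. x \<in> \<Omega> \<longrightarrow> g \<alpha> x = Dv \<Omega> v \<alpha> f x"
    and Dv_f_meas: "set_borel_measurable lebesgue \<Omega> (Dv \<Omega> v \<alpha> f)" if \<alpha>: "\<alpha> \<in> pim m" for \<alpha>
  proof -
    have "(AE x in lebesgue. x \<in> \<Omega> \<longrightarrow> g \<alpha> x = Dv \<Omega> v \<alpha> f x) \<and> set_borel_measurable lebesgue \<Omega> (Dv \<Omega> v \<alpha> f)"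
    proof (cases "mlen \<alpha> = 0")
      case True
      then show ?thesis using f0 by (auto simp: mlen_eq_0 Dv_zero f_def Lpw_def)
    next
      case False
      note D = is_wderiv_Dv[OF False wd[OF \<alpha> False]]
      from is_wderiv_unique[OF wd[OF \<alpha> False] D] D show ?thesis
        by (simp add: is_wderiv_def L1w_loc_def)
    qed
    then show "AE x in lebesgue. x \<in> \<Omega> \<longrightarrow> g \<alpha> x = Dv \<Omega> v \<alpha> f x"
      and "set_borel_measurable lebesgue \<Omega> (Dv \<Omega> v \<alpha> f)" by auto
  qed
  have Dv_f_Lpw: "Dv \<Omega> v \<alpha> f \<in> Lpw p \<Omega> (w \<alpha>)" if \<alpha>: "\<alpha> \<in> pim m" for \<alpha>
    by (rule Lpw_AE_cong[OF \<alpha> g[OF \<alpha>] Dv_f_meas[OF \<alpha>] Dv_f[OF \<alpha>]])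
  have f: "f \<in> Wsp m p \<Omega> w v"
    unfolding Wsp_def using f0 wd Dv_f_Lpw by blast
  have "(\<lambda>n. LINT x:\<Omega>|lebesgue. \<bar>w \<alpha> x * Dv \<Omega> v \<alpha> (\<lambda>x. F n x - f x) x\<bar> powr p) \<longlonglongrightarrow> 0"
    if \<alpha>: "\<alpha> \<in> pim m" for \<alpha>
  proof -
    have meas: "set_borel_measurable lebesgue \<Omega> (\<lambda>x. Dv \<Omega> v \<alpha> (F n) x - h x)" if "h \<in> Lpw p \<Omega> (w \<alpha>)" for n h
      using Lpw_diff[OF \<alpha> Wsp_Dv_Lpw[OF F \<alpha>] that, of n] by (simp add: Lpw_def)
    have "(LINT x:\<Omega>|lebesgue. \<bar>(Dv \<Omega> v \<alpha> (F n) x - g \<alpha> x) * w \<alpha> x\<bar> powr p) =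
        (LINT x:\<Omega>|lebesgue. \<bar>w \<alpha> x * Dv \<Omega> v \<alpha> (\<lambda>x. F n x - f x) x\<bar> powr p)" for n
      unfolding Wnorm_diff_term[OF F f \<alpha>]
      by (rule set_integral_powr_cong[OF \<alpha> _ meas[OF g[OF \<alpha>]] meas[OF Dv_f_Lpw[OF \<alpha>]]])
        (use Dv_f[OF \<alpha>] in \<open>eventually_elim, auto\<close>)
    then show ?thesis using lim[OF \<alpha>] by simp
  qed
  then have "(\<lambda>n. \<Sum>\<alpha>\<in>pim m. LINT x:\<Omega>|lebesgue. \<bar>w \<alpha> x * Dv \<Omega> v \<alpha> (\<lambda>x. F n x - f x) x\<bar> powr p) \<longlonglongrightarrow> 0"
    by (rule tendsto_null_sum)
  \<comment> \<open>The \<open>p\<close>-th root is continuous at 0 along nonnegative sums, and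
    \<open>0 powr (1 / p)\<close> equals 0.\<close>
  then have "(\<lambda>n. Wnorm m p \<Omega> w v (\<lambda>x. F n x - f x)) \<longlonglongrightarrow> 0 powr (1 / p)"
    unfolding Wnorm_def
    by (rule tendsto_powr2[OF _ tendsto_const])
      (use p_pos in \<open>auto intro!: always_eventually sum_nonneg set_integral_powr_nonneg\<close>)
  then show ?thesis using f by auto
qed

end

theorem theorem4:
  fixes \<Omega> :: "(real^'n::finite) set" and p :: real and m :: nat
    and w :: "'n mindex \<Rightarrow> real^'n \<Rightarrow> real" and v :: "real^'n \<Rightarrow> real"
  assumes "open \<Omega>" and "1 \<le> p"
    and "\<forall>\<alpha>\<in>pim m. w \<alpha> \<in> Ep p \<Omega>"
    and "Ck_on m \<Omega> v" and "AE x in lebesgue. x \<in> \<Omega> \<longrightarrow> v x \<noteq> 0"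
    and "\<forall>\<alpha>\<in>pim m. \<forall>K. compact K \<and> K \<subseteq> \<Omega> \<longrightarrow>
           (\<exists>C>0. AE x in lebesgue. x \<in> K \<longrightarrow> \<bar>v x\<bar> ^ (mlen \<alpha> + 1) \<le> C * \<bar>w \<alpha> x\<bar>)"
  shows "\<forall>F. (\<forall>n. F n \<in> Wsp m p \<Omega> w v) \<and>
             (\<forall>e>0. \<exists>N. \<forall>n\<ge>N. \<forall>k\<ge>N. Wnorm m p \<Omega> w v (\<lambda>x. F n x - F k x) < e)
           \<longrightarrow> (\<exists>f\<in>Wsp m p \<Omega> w v. (\<lambda>n. Wnorm m p \<Omega> w v (\<lambda>x. F n x - f x)) \<longlonglongrightarrow> 0)"
proof -
  interpret weighted_sobolev \<Omega> p m w v
    by unfold_locales (use assms in blast)+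
  show ?thesis
    by (intro allI impI Wsp_complete) blast+
qed

end
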